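(* Let $\beta>2.424$. The Minimum Vertex Cover problem on random power law graphs drawn from the $(\alpha,\beta)$-model $M(\alpha,\beta)$ can be approximated in polynomial time with expected asymptotic (as $\alpha\to\infty$) approximation ratio \[\rho' = 2-\frac{\left(\zeta(\beta)-1-\frac{1}{2^{\beta}}\right)\zeta(\beta-1)}{\zeta(\beta-1)\,\zeta(\beta)}\left[1-\left(\frac{\zeta(\beta-1)-\left(1+\frac{1}{2^{\beta-1}}\right)}{\zeta(\beta-1)}\right)^{3}\right],\] where $\zeta$ is the Riemann zeta function.
   Context: Minimum Vertex Cover: given an undirected (multi)graph $G=(V,E)$, find a set $C\subseteq V$ of minimum cardinality such that every edge has at least one endpoint in $C$. The $(\alpha,\beta)$-model $M(\alpha,\beta)$ (Aiello–Chung–Lu): for real parameters $\alpha>0$, $\beta>0$, let $\Delta=\lfloor e^{\alpha/\beta}\rfloor$; for each $1\le i\le\Delta$ there are $y_i$ vertices of degree $i$, where $y_i=\lfloor e^{\alpha}/i^{\beta}\rfloor$ if $i>1$ or if $\sum_{i=1}^{\Delta}\lfloor e^{\alpha}/i^{\beta}\rfloor$ is even, and $y_1=\lfloor e^{\alpha}\rfloor+1$ otherwise. A random multigraph (self-loops and multi-edges allowed) is generated by creating $\deg(v)$ copies of each vertex $v$, taking a uniformly random perfect matching on all copies, and letting the number of edges between $u$ and $v$ equal the number of matched pairs joining a copy of $u$ and a copy of $v$. Following the paper, $e^{\alpha}/i^{\beta}$ and $e^{\alpha/\beta}$ are used in place of their integer parts. The expected approximation ratio refers to expectation over $G\sim M(\alpha,\beta)$;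 "asymptotic" means the bound holds in the limit $\alpha\to\infty$.
   Formalization: The extra degree-1 vertex is added when the sum of the degrees (not the number of vertices) is odd, since otherwise no perfect matching on the copies need exist; the two rules agree whenever the printed one is meaningful. Vertices are numbered by increasing degree. *)

theory Defs
  imports "HOL-Probability.Probability" "HOL-Library.Uprod"
begin

section \<open>Multigraphs and vertex covers\<close>

text \<open>
  The vertices are \<open>{..<num_verts G}\<close>.  The edge \<open>Upair u u\<close> is a self-loop at \<open>u\<close>;
  \<open>count (edges G) (Upair u v)\<close> is the number of edges between \<open>u\<close> and \<open>v\<close>.
\<close>

record multigraph =
  num_verts :: nat
  edges :: "nat uprod multiset"

definition wf_multigraph :: "multigraph \<Rightarrow> bool" where
  "wf_multigraph G \<longleftrightarrow> (\<forall>e \<in># edges G. set_uprod e \<subseteq> {..<num_verts G})"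

definition vertex_cover :: "multigraph \<Rightarrow> nat set \<Rightarrow> bool" where
  "vertex_cover G C \<longleftrightarrow>
     C \<subseteq> {..<num_verts G} \<and> (\<forall>e \<in># edges G. set_uprod e \<inter> C \<noteq> {})"

definition min_vc_size :: "multigraph \<Rightarrow> nat" where
  "min_vc_size G = Min (card ` {C. vertex_cover G C})"

definition approx_ratio :: "(multigraph \<Rightarrow> nat set) \<Rightarrow> multigraph \<Rightarrow> real" where
  "approx_ratio A G = real (card (A G)) / real (min_vc_size G)"


section \<open>The random power law multigraph\<close>

definition max_degree :: "real \<Rightarrow> real \<Rightarrow> nat" where
  "max_degree \<alpha> \<beta> = nat \<lfloor>exp (\<alpha> / \<beta>)\<rfloor>"

definition base_count :: "real \<Rightarrow> real \<Rightarrow> nat \<Rightarrow> nat" where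
  "base_count \<alpha> \<beta> i = nat \<lfloor>exp \<alpha> / real i powr \<beta>\<rfloor>"

text \<open>
  The additional vertex of degree 1 makes the number of vertex copies even, which is necessary and
  sufficient for a perfect matching on the copies to exist.  The parity is therefore taken of the
  sum of the degrees.  The model is sometimes printed with the parity of the number of
  vertices instead (\<open>degree_count_by_vertex_parity\<close> below); that variant need not have an even
  degree sum, but whenever it does, it coincides with the one used here.
\<close>

definition degree_count :: "real \<Rightarrow> real \<Rightarrow> nat \<Rightarrow> nat" where
  "degree_count \<alpha> \<beta> i =
     (if i > 1 \<or> even (\<Sum>k = 1..max_degree \<alpha> \<beta>. k * base_count \<alpha> \<beta> k)
      then base_count \<alpha> \<beta> i else nat \<lfloor>exp \<alpha>\<rfloor> + 1)"

definition degree_count_by_vertex_parity :: "real \<Rightarrow> real \<Rightarrow> nat \<Rightarrow> nat" where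
  "degree_count_by_vertex_parity \<alpha> \<beta> i =
     (if i > 1 \<or> even (\<Sum>k = 1..max_degree \<alpha> \<beta>. base_count \<alpha> \<beta> k)
      then base_count \<alpha> \<beta> i else nat \<lfloor>exp \<alpha>\<rfloor> + 1)"

definition degree_list :: "real \<Rightarrow> real \<Rightarrow> nat list" where
  "degree_list \<alpha> \<beta> =
     concat (map (\<lambda>i. replicate (degree_count \<alpha> \<beta> i) i) [1..<Suc (max_degree \<alpha> \<beta>)])"

definition vertex_copies :: "nat list \<Rightarrow> (nat \<times> nat) set" where
  "vertex_copies ds = (SIGMA v:{..<length ds}. {..<ds ! v})"

definition perfect_matchings :: "'a set \<Rightarrow> 'a uprod set set" where
  "perfect_matchings S =
     {M. (\<forall>e\<in>M. proper_uprod e \<and> set_uprod e \<subseteq> S) \<and> (\<forall>x\<in>S. \<exists>!e. e \<in> M \<and> x \<in> set_uprod e)}"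

definition graph_of_matching :: "nat \<Rightarrow> (nat \<times> nat) uprod set \<Rightarrow> multigraph" where
  "graph_of_matching n M =
     \<lparr>num_verts = n, edges = image_mset (map_uprod fst) (mset_set M)\<rparr>"

definition power_law_graph :: "real \<Rightarrow> real \<Rightarrow> multigraph pmf" where
  "power_law_graph \<alpha> \<beta> =
     (let ds = degree_list \<alpha> \<beta> in
        map_pmf (graph_of_matching (length ds))
          (pmf_of_set (perfect_matchings (vertex_copies ds))))"


subsection \<open>Well-definedness of the model\<close>

lemma sum_degree_count:
  assumes "\<alpha> > 0" "\<beta> > 0"
  shows "(\<Sum>i = 1..max_degree \<alpha> \<beta>. i * (if i > 1 \<or> b then base_count \<alpha> \<beta> i else nat \<lfloor>exp \<alpha>\<rfloor> + 1)) =
         (\<Sum>i = 1..max_degree \<alpha> \<beta>. i * base_count \<alpha> \<beta> i) + (if b then 0 else 1)"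
proof -
  have "exp (\<alpha> / \<beta>) \<ge> 1" using assms by simp
  hence "1 \<le> \<lfloor>exp (\<alpha> / \<beta>)\<rfloor>" by linarith
  hence le: "1 \<le> max_degree \<alpha> \<beta>" unfolding max_degree_def by linarith
  have base_count_1: "base_count \<alpha> \<beta> 1 = nat \<lfloor>exp \<alpha>\<rfloor>" by (simp add: base_count_def)
  have rest: "(\<Sum>i = Suc 1..max_degree \<alpha> \<beta>.
        i * (if i > 1 \<or> b then base_count \<alpha> \<beta> i else nat \<lfloor>exp \<alpha>\<rfloor> + 1)) =
      (\<Sum>i = Suc 1..max_degree \<alpha> \<beta>. i * base_count \<alpha> \<beta> i)"
    by (intro sum.cong) auto
  show ?thesis
    unfolding sum.atLeast_Suc_atMost[OF le] rest base_count_1 by simp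
qed

lemma even_degree_sum:
  assumes "\<alpha> > 0" "\<beta> > 0"
  shows "even (\<Sum>i = 1..max_degree \<alpha> \<beta>. i * degree_count \<alpha> \<beta> i)"
  unfolding degree_count_def sum_degree_count[OF assms] by simp

lemma degree_count_by_vertex_parity_eq:
  assumes "\<alpha> > 0" "\<beta> > 0"
    and "even (\<Sum>i = 1..max_degree \<alpha> \<beta>. i * degree_count_by_vertex_parity \<alpha> \<beta> i)"
  shows "degree_count_by_vertex_parity \<alpha> \<beta> = degree_count \<alpha> \<beta>"
  using assms(3)
  unfolding degree_count_def degree_count_by_vertex_parity_def sum_degree_count[OF assms(1,2)]
  by (auto simp: fun_eq_iff split: if_splits)

lemma sum_list_degree_list:
  "sum_list (degree_list \<alpha> \<beta>) = (\<Sum>i = 1..max_degree \<alpha> \<beta>. i * degree_count \<alpha> \<beta> i)"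
proof -
  have "sum_list (concat (map (\<lambda>i. replicate (f i) i) xs)) = (\<Sum>i\<leftarrow>xs. i * f i)"
    for xs :: "nat list" and f by (induction xs) (auto simp: sum_list_replicate)
  thus ?thesis
    unfolding degree_list_def
    by (simp add: sum_list_distinct_conv_sum_set atLeastLessThanSuc_atLeastAtMost
        del: upt_Suc)
qed

lemma card_vertex_copies: "card (vertex_copies ds) = sum_list ds"
  unfolding vertex_copies_def by (simp add: sum_list_sum_nth atLeast0LessThan)

lemma finite_vertex_copies: "finite (vertex_copies ds)"
  unfolding vertex_copies_def by simp

lemma finite_perfect_matchings:
  assumes "finite S"
  shows "finite (perfect_matchings S)"
proof (rule finite_subset)
  show "perfect_matchings S \<subseteq> Pow ((\<lambda>(x, y). Upair x y) ` (S \<times> S))"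
  proof (intro subsetI PowI)
    fix M e assume "M \<in> perfect_matchings S" "e \<in> M"
    thus "e \<in> (\<lambda>(x, y). Upair x y) ` (S \<times> S)"
      by (cases e) (force simp: perfect_matchings_def)
  qed
qed (use assms in auto)

lemma perfect_matchings_nonempty:
  assumes "finite S" "even (card S)"
  shows "perfect_matchings S \<noteq> {}"
  using assms
proof (induction "card S" arbitrary: S rule: less_induct)
  case less
  show ?case
  proof (cases "S = {}")
    case True
    thus ?thesis by (auto simp: perfect_matchings_def)
  next
    case False
    then obtain x where x: "x \<in> S" by auto
    have "card S \<noteq> 1" using less.prems by auto
    hence "S \<noteq> {x}" by auto
    then obtain y where y: "y \<in> S" "y \<noteq> x" using x by auto
    have c: "card (S - {x, y}) = card S - 2"
      using x y less.prems by (subst card_Diff_subset) auto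
    have "card S > 0" using x less.prems by (auto simp: card_gt_0_iff)
    hence "perfect_matchings (S - {x, y}) \<noteq> {}"
      using less.prems c by (intro less.hyps) auto
    then obtain M where M_matching: "M \<in> perfect_matchings (S - {x, y})" by blast
    have M: "proper_uprod e \<and> set_uprod e \<subseteq> S - {x, y}" if "e \<in> M" for e
      using M_matching that by (simp add: perfect_matchings_def)
    have M': "\<exists>!e. e \<in> M \<and> z \<in> set_uprod e" if "z \<in> S - {x, y}" for z
      using M_matching that by (simp add: perfect_matchings_def)
    have "\<exists>!e. e \<in> insert (Upair x y) M \<and> z \<in> set_uprod e" if "z \<in> S" for z
    proof (cases "z \<in> {x, y}")
      case True
      hence "z \<in> set_uprod (Upair x y)" "\<And>e. e \<in> M \<Longrightarrow> z \<notin> set_uprod e"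
        using M by auto
      thus ?thesis by blast
    next
      case False
      hence "z \<notin> set_uprod (Upair x y)" "z \<in> S - {x, y}" using that by auto
      thus ?thesis using M'[of z] by blast
    qed
    moreover have "proper_uprod e \<and> set_uprod e \<subseteq> S" if "e \<in> insert (Upair x y) M" for e
      using that
    proof
      assume "e = Upair x y"
      thus ?thesis using x y by simp
    next
      assume "e \<in> M"
      thus ?thesis using M by blast
    qed
    ultimately have "insert (Upair x y) M \<in> perfect_matchings S"
      unfolding perfect_matchings_def by blast
    thus ?thesis by blast
  qed
qed

lemma set_pmf_power_law_graph:
  assumes "\<alpha> > 0" "\<beta> > 0"
  shows "set_pmf (power_law_graph \<alpha> \<beta>) =
    graph_of_matching (length (degree_list \<alpha> \<beta>)) `
      perfect_matchings (vertex_copies (degree_list \<alpha> \<beta>))"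
proof -
  have "even (card (vertex_copies (degree_list \<alpha> \<beta>)))"
    using even_degree_sum[OF assms] by (simp add: card_vertex_copies sum_list_degree_list)
  thus ?thesis
    unfolding power_law_graph_def Let_def
    by (simp add: finite_perfect_matchings perfect_matchings_nonempty
        finite_vertex_copies)
qed


section \<open>Deterministic multi-tape Turing machines\<close>

text \<open>
  States \<open>0, \<dots>, tm_states - 1\<close> are the non-halting states, 0 is the initial state, and \<open>tm_states\<close>
  is the halting state.  Symbol 0 is the blank.  Tapes are two-way infinite; the input is
  on the first tape, the output is on the last one.
\<close>

datatype head_move = Move_Left | Stay | Move_Right

record tm =
  tm_tapes :: nat
  tm_symbols :: nat
  tm_states :: nat
  tm_delta :: "nat \<Rightarrow> nat list \<Rightarrow> nat \<times> (nat \<times> head_move) list"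

definition turing_machine :: "tm \<Rightarrow> bool" where
  "turing_machine M \<longleftrightarrow> tm_tapes M \<ge> 1 \<and>
     (\<forall>q < tm_states M. \<forall>ss. length ss = tm_tapes M \<and> set ss \<subseteq> {..<tm_symbols M} \<longrightarrow>
        (case tm_delta M q ss of (q', acts) \<Rightarrow>
           q' \<le> tm_states M \<and> length acts = tm_tapes M \<and> fst ` set acts \<subseteq> {..<tm_symbols M}))"

type_synonym tape = "(int \<Rightarrow> nat) \<times> int"
type_synonym config = "nat \<times> tape list"

fun read_tape :: "tape \<Rightarrow> nat" where
  "read_tape (t, h) = t h"

fun move_head :: "head_move \<Rightarrow> int \<Rightarrow> int" where
  "move_head Move_Left h = h - 1"
| "move_head Stay h = h"
| "move_head Move_Right h = h + 1"

fun act_tape :: "tape \<Rightarrow> nat \<times> head_move \<Rightarrow> tape" where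
  "act_tape (t, h) (s, m) = (t(h := s), move_head m h)"

fun tm_step :: "tm \<Rightarrow> config \<Rightarrow> config" where
  "tm_step M (q, ts) =
     (if q < tm_states M
      then (case tm_delta M q (map read_tape ts) of (q', acts) \<Rightarrow> (q', map2 act_tape ts acts))
      else (q, ts))"

definition word_tape :: "nat list \<Rightarrow> int \<Rightarrow> nat" where
  "word_tape w i = (if 0 \<le> i \<and> i < int (length w) then w ! nat i else 0)"

definition init_config :: "tm \<Rightarrow> nat list \<Rightarrow> config" where
  "init_config M w =
     (0, (word_tape w, 0) # replicate (tm_tapes M - 1) (word_tape [], 0))"

definition tm_outputs_within :: "tm \<Rightarrow> nat list \<Rightarrow> nat \<Rightarrow> nat list \<Rightarrow> bool" where
  "tm_outputs_within M w t v \<longleftrightarrow>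
     (case (tm_step M ^^ t) (init_config M w) of (q, ts) \<Rightarrow>
        q = tm_states M \<and> fst (last ts) = word_tape v)"

definition poly_time_computable :: "('a \<Rightarrow> nat list) \<Rightarrow> ('a \<Rightarrow> nat list) \<Rightarrow> 'a set \<Rightarrow> bool" where
  "poly_time_computable enc_in enc_out D \<longleftrightarrow>
     (\<exists>M c d. turing_machine M \<and>
        (\<forall>x\<in>D. set (enc_in x) \<subseteq> {..<tm_symbols M} \<and>
           tm_outputs_within M (enc_in x) (c * length (enc_in x) ^ d + c) (enc_out x)))"


section \<open>Polynomial-time vertex cover algorithms\<close>

text \<open>
  A multigraph is encoded by its adjacency matrix, row by row: each entry is the multiplicity
  in unary (symbol 1) followed by 2, and each row ends with 3.  Since every edge contributes at
  least one symbol, the length is polynomially equivalent to the number of vertices plus edges.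
  A set of vertices is encoded by its characteristic vector over the symbols 1 (no) and 2 (yes).
\<close>

definition encode_graph :: "multigraph \<Rightarrow> nat list" where
  "encode_graph G =
     concat (map (\<lambda>u.
         concat (map (\<lambda>v. replicate (count (edges G) (Upair u v)) 1 @ [2]) [0..<num_verts G]) @ [3])
       [0..<num_verts G])"

definition encode_vertex_set :: "nat \<Rightarrow> nat set \<Rightarrow> nat list" where
  "encode_vertex_set n C = map (\<lambda>v. if v \<in> C then 2 else 1) [0..<n]"

definition poly_time_vc_algorithm :: "(multigraph \<Rightarrow> nat set) \<Rightarrow> bool" where
  "poly_time_vc_algorithm A \<longleftrightarrow>
     (\<forall>G. wf_multigraph G \<longrightarrow> vertex_cover G (A G)) \<and>
     poly_time_computable encode_graph (\<lambda>G. encode_vertex_set (num_verts G) (A G))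
       {G. wf_multigraph G}"


section \<open>The approximation ratio\<close>

text \<open>The Riemann zeta function at real arguments \<open>s > 1\<close>, the only ones that are needed.\<close>

definition zeta :: "real \<Rightarrow> real" where
  "zeta s = (\<Sum>n. 1 / real (Suc n) powr s)"

definition rho' :: "real \<Rightarrow> real" where
  "rho' \<beta> = 2 - ((zeta \<beta> - 1 - 1 / 2 powr \<beta>) * zeta (\<beta> - 1)) / (zeta (\<beta> - 1) * zeta \<beta>) *
     (1 - ((zeta (\<beta> - 1) - (1 + 1 / 2 powr (\<beta> - 1))) / zeta (\<beta> - 1)) ^ 3)"

end

theory Submission
  imports Defs
begin

text \<open>
  The algorithm runs through the vertices in order.  An unmarked vertex with a loop is marked;
  otherwise an unmarked vertex \<open>u\<close> marks its first unmarked later neighbour, and itself as well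
  unless that neighbour is joined to it by its only edge.

  In a graph of the model the vertices are sorted by degree, so the leaves are served first.  The
  bound then holds for every graph in the support and not just in expectation.  Let \<open>X\<close> be the set
  of vertices marked while the leaves are processed, \<open>C\<close> the final cover, and \<open>N\<close> the number of
  vertices of degree at least 2.  Every step uses up a vertex of an optimal cover \<open>D\<close>, and leaf steps
  mark only one vertex, so \<open>|C| + |X| \<le> 2 |D|\<close>; later steps mark no leaves, so \<open>|C| \<le> |X| + N\<close>.
  Finally every leaf is in \<open>X\<close> or next to it, so there are at most
  \<open>8 |X| + (\<Sum>i. (i - 8) y\<^sub>i)\<close> leaves, where \<open>i\<close> ranges over the degrees above 8.  Since
  \<open>\<Sum>i > 8. (i - 8) / i powr \<beta>\<close> is well below 1 for \<open>\<beta> > 2.424\<close>, this forces \<open>|X|\<close> to be large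
  enough to beat \<open>2\<close> by the required amount.
\<close>

section \<open>The greedy rule and a Turing machine for it\<close>

text \<open>The memory of the automaton that scans one row. \<open>tally\<close> counts the edges
  seen, capped at two: enough to tell a leaf from other vertices. The phase is \<open>Before\<close>
  up to the diagonal; there it becomes \<open>Idle\<close> if the row's vertex is marked or has a
  loop, and \<open>Searching\<close> otherwise, until a partner is found.\<close>

datatype tally = Nought | Single | Several
datatype phase = Before | Searching | Idle | Matched
datatype state = Scan tally bool phase | Seek bool | Return

fun bump :: "tally \<Rightarrow> tally" where
  "bump Nought = Single" | "bump Single = Several" | "bump Several = Several"

fun decide :: "phase \<Rightarrow> bool \<Rightarrow> bool \<Rightarrow> phase \<times> bool" where
  "decide Before e marked = (if e \<or> marked then Idle else Searching, e)"
| "decide Searching e marked = (if e \<and> \<not> marked then (Matched, True) else (Searching, False))"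
| "decide b e marked = (b, False)"

definition scan_col :: "(nat \<Rightarrow> nat) \<Rightarrow> nat \<Rightarrow> nat \<Rightarrow> tally \<times> phase \<times> nat set \<Rightarrow> tally \<times> phase \<times> nat set" where
  "scan_col c u v = (\<lambda>(r, b, X).
     let (b', m) = (if v < u then (b, False) else decide b (c v > 0) (v \<in> X))
     in ((bump ^^ c v) r, b', if m then insert v X else X))"

text \<open>Whether \<open>u\<close> is marked along with its partner is decided only after the last
  column, since further edges may follow the partner.\<close>

definition scan_row :: "nat \<Rightarrow> (nat \<Rightarrow> nat) \<Rightarrow> nat \<Rightarrow> nat set \<Rightarrow> nat set" where
  "scan_row n c u X =
     (case fold (scan_col c u) [0..<n] (Nought, Before, X) of
        (r, b, Y) \<Rightarrow> if b = Matched \<and> r = Several then insert u Y else Y)"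

definition edge_mult :: "multigraph \<Rightarrow> nat \<Rightarrow> nat \<Rightarrow> nat" where
  "edge_mult G u v = count (edges G) (Upair u v)"

definition leaf_greedy_upto :: "multigraph \<Rightarrow> nat \<Rightarrow> nat set" where
  "leaf_greedy_upto G k = fold (\<lambda>u. scan_row (num_verts G) (edge_mult G u) u) [0..<k] {}"

definition leaf_greedy :: "multigraph \<Rightarrow> nat set" where
  "leaf_greedy G = leaf_greedy_upto G (num_verts G)"

text \<open>
  The tapes hold the input, the index of the current row in unary, and the marks (0 or 1: unmarked,
  2: marked).  The heads of the last two stay at the current column, so the unary counter shows whether
  the column lies before the diagonal; it is incremented on the diagonal.  In \<open>Seek f\<close> the heads
  return to the diagonal, where the row's own vertex is marked if \<open>f\<close> holds; in \<open>Return\<close> they go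
  on to the first column.  State 27 is the halting state.
\<close>

fun transition :: "state \<Rightarrow> nat \<Rightarrow> nat \<Rightarrow> nat \<Rightarrow> state option \<times> (nat \<times> head_move) list" where
  "transition (Scan r e b) a x y =
     (if a = 1 then
        (Some (Scan (bump r) True b), [(a, Move_Right), (x, Stay), (y, Stay)])
      else if a = 2 then
        (if x = 1 then
           (Some (Scan r False b), [(a, Move_Right), (x, Move_Right), (y, Move_Right)])
         else case decide b e (y = 2) of (b', m) \<Rightarrow>
           (Some (Scan r False b'),
            [(a, Move_Right), (of_bool (b = Before), Move_Right),
             (if m \<or> y = 2 then 2 else 1, Move_Right)]))
      else if a = 3 then
        (Some (Seek (b = Matched \<and> r = Several)), [(a, Move_Right), (x, Stay), (y, Stay)])
      else (None, [(a, Stay), (x, Stay), (y, Stay)]))"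
| "transition (Seek f) a x y =
     (if x = 1 then
        (Some Return, [(a, Stay), (x, Move_Left), (if f then 2 else y, Move_Left)])
      else (Some (Seek f), [(a, Stay), (x, Move_Left), (y, Move_Left)]))"
| "transition Return a x y =
     (if x = 1 then (Some Return, [(a, Stay), (x, Move_Left), (y, Move_Left)])
      else (Some (Scan Nought False Before), [(a, Stay), (x, Move_Right), (y, Move_Right)]))"

text \<open>Mixed-radix numbering with digits in base 3, 2 and 4; the start state
  \<open>Scan Nought False Before\<close> gets 0, as \<open>init_config\<close> demands.\<close>

fun code :: "state \<Rightarrow> nat" where
  "code (Scan r e b) =
     (case r of Nought \<Rightarrow> 0 | Single \<Rightarrow> 1 | Several \<Rightarrow> 2) + 3 * of_bool e +
     6 * (case b of Before \<Rightarrow> 0 | Searching \<Rightarrow> 1 | Idle \<Rightarrow> 2 | Matched \<Rightarrow> 3)"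
| "code (Seek f) = 24 + of_bool f"
| "code Return = 26"

declare code.simps [simp del]

lemma code_less: "code s < 27"
  by (cases s) (auto simp: code.simps split: tally.split phase.split)

definition decode :: "nat \<Rightarrow> state" where
  "decode q =
     (if q = 26 then Return
      else if q \<ge> 24 then Seek (q = 25)
      else Scan (if q mod 3 = 0 then Nought else if q mod 3 = 1 then Single else Several) (odd (q div 3))
        (if q < 6 then Before else if q < 12 then Searching else if q < 18 then Idle else Matched))"

lemma decode_code [simp]: "decode (code s) = s"
proof (cases s)
  case (Scan r e b)
  thus ?thesis by (cases r; cases e; cases b) (simp_all add: code.simps decode_def)
qed (simp_all add: code.simps decode_def)

definition vc_tm :: tm where
  "vc_tm = \<lparr>tm_tapes = 3, tm_symbols = 4, tm_states = 27,
     tm_delta = (\<lambda>q ss. case transition (decode q) (ss ! 0) (ss ! 1) (ss ! 2) of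
        (s, acts) \<Rightarrow> (case s of None \<Rightarrow> 27 | Some s' \<Rightarrow> code s', acts))\<rparr>"

lemma turing_machine_vc_tm: "turing_machine vc_tm"
proof -
  have ok: "(case s' of None \<Rightarrow> 27 | Some s' \<Rightarrow> code s') \<le> 27 \<and> length acts = 3 \<and>
      fst ` set acts \<subseteq> {..<4}"
    if "transition s a x y = (s', acts)" "a < 4" "x < 4" "y < 4" for s a x y s' acts
  proof -
    have "(case s' of None \<Rightarrow> 27 | Some s' \<Rightarrow> code s') \<le> 27"
      using code_less by (auto split: option.split intro: less_imp_le)
    moreover have "length acts = 3 \<and> fst ` set acts \<subseteq> {..<4}"
      using that by (cases s) (auto split: if_splits prod.splits)
    ultimately show ?thesis by blast
  qed
  show ?thesis
    unfolding turing_machine_def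
  proof (intro conjI allI impI)
    fix q ss assume ss: "length ss = tm_tapes vc_tm \<and> set ss \<subseteq> {..<tm_symbols vc_tm}"
    have "ss ! i < 4" if "i < 3" for i
      using ss that nth_mem[of i ss] by (auto simp: vc_tm_def simp del: nth_mem)
    hence "ss ! 0 < 4" "ss ! 1 < 4" "ss ! 2 < 4" by auto
    thus "case tm_delta vc_tm q ss of (q', acts) \<Rightarrow> q' \<le> tm_states vc_tm \<and>
        length acts = tm_tapes vc_tm \<and> fst ` set acts \<subseteq> {..<tm_symbols vc_tm}"
      using ok[of "decode q" "ss ! 0" "ss ! 1" "ss ! 2"]
      by (auto simp: vc_tm_def split: prod.splits)
  qed (simp add: vc_tm_def)
qed

section \<open>Runs of the machine on encoded graphs\<close>

definition unary_tape :: "nat \<Rightarrow> int \<Rightarrow> nat" where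
  "unary_tape k i = of_bool (0 \<le> i \<and> i < int k)"

text \<open>The marks are stored in the output encoding, so nothing has to be translated at the end.
  Only the first \<open>m\<close> cells have been written: \<open>m\<close> grows during row 0 and
  is the number of vertices afterwards.\<close>

definition mark_tape :: "nat set \<Rightarrow> nat \<Rightarrow> int \<Rightarrow> nat" where
  "mark_tape X m = word_tape (encode_vertex_set m X)"

lemma mark_tape_eq:
  "mark_tape X m i = (if 0 \<le> i \<and> i < int m then if nat i \<in> X then 2 else 1 else 0)"
  by (auto simp: mark_tape_def word_tape_def encode_vertex_set_def)

text \<open>The input is split at its head into the part read, \<open>xs\<close>, and the rest,
  \<open>ys\<close>; the other two heads share the position \<open>h\<close>.\<close>

definition conf :: "state \<Rightarrow> nat list \<Rightarrow> nat list \<Rightarrow> nat \<Rightarrow> nat set \<Rightarrow> nat \<Rightarrow> int \<Rightarrow> config" where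
  "conf s xs ys k X m h =
     (code s, [(word_tape (xs @ ys), int (length xs)), (unary_tape k, h), (mark_tape X m, h)])"

definition runs :: "config \<Rightarrow> nat \<Rightarrow> config \<Rightarrow> bool" where
  "runs c t d \<longleftrightarrow> (tm_step vc_tm ^^ t) c = d"

lemma runs_0 [simp]: "runs c 0 c"
  by (simp add: runs_def)

lemma runs_trans: "runs c s d \<Longrightarrow> runs d t e \<Longrightarrow> runs c (s + t) e"
  by (simp add: runs_def funpow_add add.commute[of s t])

text \<open>The machine never alters the input and moves the other two heads together, so a step is
  determined by the symbols \<open>x\<close>, \<open>y\<close> and the moves \<open>d\<close>,
  \<open>d'\<close>. With the new tapes given by hypotheses, each use only has to supply the update
  equations.\<close>

lemma run_step:
  assumes "transition s (word_tape (xs @ ys) (int (length xs))) (unary_tape k h) (mark_tape X m h) =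
      (Some s', [(word_tape (xs @ ys) (int (length xs)), d), (x, d'), (y, d')])"
    and "xs' @ ys' = xs @ ys" "int (length xs') = move_head d (int (length xs))"
    and "(unary_tape k)(h := x) = unary_tape k'" "(mark_tape X m)(h := y) = mark_tape X' m'"
    and "h' = move_head d' h"
  shows "runs (conf s xs ys k X m h) 1 (conf s' xs' ys' k' X' m' h')"
  using code_less[of s] assms
  by (simp add: runs_def conf_def vc_tm_def numeral_2_eq_2 del: fun_upd_apply)

lemma word_tape_append_Cons [simp]: "word_tape (xs @ a # ys) (int (length xs)) = a"
  by (simp add: word_tape_def)

lemma run_ones:
  "runs (conf (Scan r e b) xs (replicate j 1 @ ys) k X m h) j
        (conf (Scan ((bump ^^ j) r) (e \<or> j > 0) b) (xs @ replicate j 1) ys k X m h)"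
proof (induction j arbitrary: r e xs)
  case (Suc j)
  have "runs (conf (Scan r e b) xs (replicate (Suc j) 1 @ ys) k X m h) 1
     (conf (Scan (bump r) True b) (xs @ [1]) (replicate j 1 @ ys) k X m h)"
    by (rule run_step[where d' = Stay]) (auto simp: fun_eq_iff)
  from runs_trans[OF this Suc.IH] show ?case
    by (simp add: funpow_swap1)
qed simp

definition entry :: "nat \<Rightarrow> nat list" where
  "entry j = replicate j 1 @ [2]"

text \<open>The counter becomes \<open>Suc u\<close> on the diagonal itself, whence the distinction
  in \<open>k\<close>. Left of the diagonal the mark is written back as it is, so its cell must have
  been initialised already; this is why \<open>v < u\<close> has to give
  \<open>v < m\<close>.\<close>

lemma run_entry:
  assumes X: "X \<subseteq> {..<m}" and v: "v \<le> m" "v < u \<Longrightarrow> v < m"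
    and k: "k = (if v \<le> u then u else Suc u)" and b: "b = Before \<longleftrightarrow> v \<le> u"
    and res: "scan_col c u v (r, b, X) = (r', b', X')"
  shows "runs (conf (Scan r False b) xs (entry (c v) @ ys) k X m (int v)) (length (entry (c v)))
          (conf (Scan r' False b') (xs @ entry (c v)) ys (if v < u then u else Suc u) X'
             (max m (Suc v)) (int (Suc v)))"
    and "X' \<subseteq> {..<max m (Suc v)}" and "b' = Before \<longleftrightarrow> Suc v \<le> u"
proof -
  have r': "r' = (bump ^^ c v) r"
    using res by (auto simp: scan_col_def Let_def split: prod.splits)
  obtain m' where bm: "(if v < u then (b, False) else decide b (c v > 0) (v \<in> X)) = (b', m')"
    and X': "X' = (if m' then insert v X else X)"
    using res by (auto simp: scan_col_def Let_def split: prod.splits)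
  show "X' \<subseteq> {..<max m (Suc v)}" using X by (auto simp: X' less_max_iff_disj)
  show "b' = Before \<longleftrightarrow> Suc v \<le> u"
    using bm b by (cases b) (auto split: if_splits)
  have y: "mark_tape X m (int v) = 2 \<longleftrightarrow> v \<in> X"
    using X by (auto simp: mark_tape_eq)
  \<comment> \<open>This includes the columns right of the diagonal: there
    \<open>k = Suc u \<le> v\<close>.\<close>
  have x: "unary_tape k (int v) = 1 \<longleftrightarrow> v < u"
    by (auto simp: unary_tape_def k)
  have a: "word_tape (xs @ replicate (c v) (Suc 0) @ 2 # ys) (int (length xs) + int (c v)) = 2"
    using word_tape_append_Cons[of "xs @ replicate (c v) (Suc 0)" 2 ys] by simp
  have "runs (conf (Scan r' (False \<or> c v > 0) b) (xs @ replicate (c v) 1) (2 # ys) k X m (int v)) 1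
          (conf (Scan r' False b') (xs @ entry (c v)) ys (if v < u then u else Suc u) X'
             (max m (Suc v)) (int (Suc v)))"
  proof (cases "v < u")
    case True
    hence "(unary_tape k)(int v := 1) = unary_tape u" "max m (Suc v) = m"
      using v by (auto simp: unary_tape_def k fun_eq_iff)
    thus ?thesis using True bm X' x a
      by (intro run_step[where d' = Move_Right]) (auto simp: entry_def)
  next
    case False
    have 1: "(unary_tape k)(int v := of_bool (b = Before)) = unary_tape (Suc u)"
      using False b by (auto simp: unary_tape_def k fun_eq_iff)
    have 2: "(mark_tape X m)(int v := if m' \<or> v \<in> X then 2 else 1) = mark_tape X' (max m (Suc v))"
      using v by (auto simp: mark_tape_eq fun_eq_iff X')
    show ?thesis using False bm x y 1 2 a
      by (intro run_step[where d' = Move_Right]) (auto simp: entry_def simp del: fun_upd_apply)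
  qed
  from runs_trans[OF run_ones[of r False b xs "c v" "2 # ys" k X m "int v"] this[unfolded r']]
  show "runs (conf (Scan r False b) xs (entry (c v) @ ys) k X m (int v)) (length (entry (c v)))
          (conf (Scan r' False b') (xs @ entry (c v)) ys (if v < u then u else Suc u) X'
             (max m (Suc v)) (int (Suc v)))"
    by (simp add: entry_def r')
qed

lemma run_columns:
  assumes "u < n" "m = (if u = 0 then 0 else n)" "X \<subseteq> {..<m}" "v \<le> n"
    and "fold (scan_col c u) [0..<v] (Nought, Before, X) = (r, b, Y)"
  shows "runs (conf (Scan Nought False Before) xs (concat (map (\<lambda>v. entry (c v)) [0..<v]) @ ys) u X m 0)
            (length (concat (map (\<lambda>v. entry (c v)) [0..<v])))
          (conf (Scan r False b) (xs @ concat (map (\<lambda>v. entry (c v)) [0..<v])) ys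
             (if v \<le> u then u else Suc u) Y (max m v) (int v)) \<and>
        Y \<subseteq> {..<max m v} \<and> (b = Before \<longleftrightarrow> v \<le> u)"
  using assms(4,5)
proof (induction v arbitrary: r b Y ys)
  case 0
  thus ?case using assms(3) by auto
next
  case (Suc v)
  obtain r0 b0 Y0 where 0: "fold (scan_col c u) [0..<v] (Nought, Before, X) = (r0, b0, Y0)"
    by (cases "fold (scan_col c u) [0..<v] (Nought, Before, X)")
  have step: "scan_col c u v (r0, b0, Y0) = (r, b, Y)"
    using Suc.prems 0 by simp
  note IH = Suc.IH[OF _ 0]
  have le: "v \<le> max m v" and less: "v < u \<Longrightarrow> v < max m v"
    using assms(1,2) by auto
  note E = run_entry[of Y0 "max m v" v u _ b0, OF _ le less refl _ step]
  have max: "max (max m v) (Suc v) = max m (Suc v)" by simp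
  have if_eq: "(if v < u then u else Suc u) = (if Suc v \<le> u then u else Suc u)"
    by auto
  show ?case
    using runs_trans[OF conjunct1[OF IH[of "entry (c v) @ ys"]] E(1)] IH E(2,3) Suc.prems(1)
    by (simp add: max if_eq del: max.absorb1 max.absorb2)
qed

text \<open>The counter has length \<open>Suc u\<close> by now, so the first 1 met on the way left
  sits exactly at column \<open>u\<close>.\<close>

lemma run_seek:
  assumes "X \<subseteq> {..<n}" "u < n" "u \<le> j" "j \<le> n"
  shows "runs (conf (Seek f) xs ys (Suc u) X n (int j)) (Suc (j - u))
           (conf Return xs ys (Suc u) (if f then insert u X else X) n (int u - 1))"
  using assms(3,4)
proof (induction j rule: dec_induct)
  case base
  have "(unary_tape (Suc u))(int u := 1) = unary_tape (Suc u)"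
    by (auto simp: unary_tape_def fun_eq_iff)
  moreover have "(mark_tape X n)(int u := if f then 2 else mark_tape X n (int u)) =
      mark_tape (if f then insert u X else X) n"
    using assms by (auto simp: mark_tape_eq fun_eq_iff)
  ultimately have "runs (conf (Seek f) xs ys (Suc u) X n (int u)) 1
      (conf Return xs ys (Suc u) (if f then insert u X else X) n (int u - 1))"
    by (intro run_step[where d' = Move_Left and x = 1 and d = Stay and
          y = "if f then 2 else mark_tape X n (int u)"]) (auto simp: unary_tape_def)
  thus ?case by simp
next
  case (step j)
  have "runs (conf (Seek f) xs ys (Suc u) X n (int (Suc j))) 1
          (conf (Seek f) xs ys (Suc u) X n (int j))"
    using step.hyps by (intro run_step[where d' = Move_Left]) (auto simp: unary_tape_def)
  from runs_trans[OF this step.IH] step show ?case by (simp add: Suc_diff_le)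
qed

text \<open>The blank at position -1 stops the heads; \<open>j = 0\<close> is this turning
  point.\<close>

lemma run_return:
  assumes "j \<le> k"
  shows "runs (conf Return xs ys k X m (int j - 1)) (Suc j)
           (conf (Scan Nought False Before) xs ys k X m 0)"
  using assms
proof (induction j)
  case 0
  have "runs (conf Return xs ys k X m (-1)) 1 (conf (Scan Nought False Before) xs ys k X m 0)"
    by (rule run_step[where d' = Move_Right and x = "unary_tape k (-1)" and d = Stay and
          y = "mark_tape X m (-1)"]) (auto simp: unary_tape_def)
  thus ?case by simp
next
  case (Suc j)
  have "runs (conf Return xs ys k X m (int (Suc j) - 1)) 1
          (conf Return xs ys k X m (int j - 1))"
    using Suc.prems by (intro run_step[where d' = Move_Left]) (auto simp: unary_tape_def)
  from runs_trans[OF this Suc.IH] Suc.prems show ?case by simp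
qed

definition row_code :: "nat \<Rightarrow> (nat \<Rightarrow> nat) \<Rightarrow> nat list" where
  "row_code n c = concat (map (\<lambda>v. entry (c v)) [0..<n]) @ [3]"

lemma run_row:
  assumes u: "u < n" and m: "m = (if u = 0 then 0 else n)" and X: "X \<subseteq> {..<m}"
  shows "runs (conf (Scan Nought False Before) xs (row_code n c @ ys) u X m 0)
            (length (row_code n c) + n + 2)
          (conf (Scan Nought False Before) (xs @ row_code n c) ys (Suc u) (scan_row n c u X) n 0)"
    and "scan_row n c u X \<subseteq> {..<n}"
proof -
  let ?cols = "concat (map (\<lambda>v. entry (c v)) [0..<n])"
  obtain r b Y where f: "fold (scan_col c u) [0..<n] (Nought, Before, X) = (r, b, Y)"
    by (cases "fold (scan_col c u) [0..<n] (Nought, Before, X)")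
  let ?f = "b = Matched \<and> r = Several"
  have row: "scan_row n c u X = (if ?f then insert u Y else Y)"
    by (simp add: scan_row_def f)
  have max: "max m n = n" using m by auto
  note C = run_columns[OF u m X order_refl f, unfolded max]
  have Y: "Y \<subseteq> {..<n}" using C by blast
  show "scan_row n c u X \<subseteq> {..<n}" using Y u by (auto simp: row)
  have 1: "runs (conf (Scan Nought False Before) xs (?cols @ 3 # ys) u X m 0) (length ?cols)
          (conf (Scan r False b) (xs @ ?cols) (3 # ys) (Suc u) Y n (int n))"
    using C[of xs "3 # ys"] u by simp
  have a: "word_tape ((xs @ ?cols) @ 3 # ys) (int (length (xs @ ?cols))) = 3"
    by (rule word_tape_append_Cons)
  have 2: "runs (conf (Scan r False b) (xs @ ?cols) (3 # ys) (Suc u) Y n (int n)) 1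
          (conf (Seek ?f) (xs @ row_code n c) ys (Suc u) Y n (int n))"
    by (rule run_step[where d' = Stay], unfold a) (auto simp: row_code_def)
  note 3 = run_seek[OF Y u less_imp_le[OF u] order_refl, of ?f "xs @ row_code n c" ys]
  note 4 = run_return[of u "Suc u" "xs @ row_code n c" ys "scan_row n c u X" n]
  \<comment> \<open>Seeking takes \<open>n - u + 1\<close> steps and returning \<open>u + 1\<close>,
    so the overhead is \<open>n + 2\<close> in every row.\<close>
  have "length ?cols + 1 + Suc (n - u) + Suc u = length (row_code n c) + n + 2"
    using u by (simp add: row_code_def)
  thus "runs (conf (Scan Nought False Before) xs (row_code n c @ ys) u X m 0)
            (length (row_code n c) + n + 2)
          (conf (Scan Nought False Before) (xs @ row_code n c) ys (Suc u) (scan_row n c u X) n 0)"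
    using runs_trans[OF runs_trans[OF runs_trans[OF 1 2] 3] 4[unfolded row]]
    by (simp add: row row_code_def)
qed

lemma encode_graph_eq:
  "encode_graph G = concat (map (\<lambda>u. row_code (num_verts G) (edge_mult G u)) [0..<num_verts G])"
  by (simp add: encode_graph_def row_code_def entry_def edge_mult_def)

lemma run_rows:
  fixes G defines "n \<equiv> num_verts G"
  defines "code_upto \<equiv> (\<lambda>k. concat (map (\<lambda>u. row_code n (edge_mult G u)) [0..<k]))"
  assumes "k \<le> n"
  shows "runs (conf (Scan Nought False Before) [] (code_upto k @ ys) 0 {} 0 0)
           (length (code_upto k) + k * (n + 2))
          (conf (Scan Nought False Before) (code_upto k) ys k (leaf_greedy_upto G k)
             (if k = 0 then 0 else n) 0) \<and>
        leaf_greedy_upto G k \<subseteq> {..<if k = 0 then 0 else n}"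
  using assms(3)
proof (induction k arbitrary: ys)
  case 0
  show ?case by (simp add: code_upto_def leaf_greedy_upto_def)
next
  case (Suc k)
  hence k: "k < n" by simp
  note IH = Suc.IH[OF less_imp_le[OF k]]
  have step: "leaf_greedy_upto G (Suc k) = scan_row n (edge_mult G k) k (leaf_greedy_upto G k)"
    by (simp add: leaf_greedy_upto_def n_def)
  have code: "code_upto (Suc k) = code_upto k @ row_code n (edge_mult G k)"
    by (simp add: code_upto_def)
  note R = run_row[OF k refl conjunct2[OF IH]]
  show ?case
    using runs_trans[OF conjunct1[OF IH[of "row_code n (edge_mult G k) @ ys"]] R(1)] R(2)
    by (simp add: step code algebra_simps)
qed

text \<open>Each row has one separator per column and an end mark. This makes the quadratic overhead
  of moving the heads back linear in the input length.\<close>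

lemma length_encode_graph_ge: "num_verts G * (num_verts G + 1) \<le> length (encode_graph G)"
proof -
  have row: "num_verts G + 1 \<le> length (row_code (num_verts G) c)" for c
  proof -
    have "k \<le> length (concat (map (\<lambda>v. entry (c v)) [0..<k]))" for k
      by (induction k) (auto simp: entry_def)
    thus ?thesis by (simp add: row_code_def)
  qed
  have "k * (num_verts G + 1) \<le>
      length (concat (map (\<lambda>u. row_code (num_verts G) (edge_mult G u)) [0..<k]))" for k
  proof (induction k)
    case (Suc k)
    thus ?case using row[of "edge_mult G k"] by simp
  qed simp
  thus ?thesis by (simp add: encode_graph_eq)
qed

lemma poly_time_computable_leaf_greedy:
  "poly_time_computable encode_graph (\<lambda>G. encode_vertex_set (num_verts G) (leaf_greedy G)) D"
  unfolding poly_time_computable_def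
proof (intro exI conjI ballI)
  show "turing_machine vc_tm" by (rule turing_machine_vc_tm)
next
  fix G :: multigraph
  show "set (encode_graph G) \<subseteq> {..<tm_symbols vc_tm}"
    by (auto simp: encode_graph_def vc_tm_def)
next
  fix G :: multigraph
  define n where "n = num_verts G"
  define l where "l = length (encode_graph G)"
  define t where "t = l + n * (n + 2)"
  \<comment> \<open>The halting configuration, reached on reading the blank after the input.\<close>
  define e where "e = (27 :: nat, [(word_tape (encode_graph G), int l), (unary_tape n, 0::int),
    (word_tape (encode_vertex_set n (leaf_greedy G)), 0::int)])"
  have m: "mark_tape (leaf_greedy G) (if n = 0 then 0 else n) =
      word_tape (encode_vertex_set n (leaf_greedy G))"
    by (simp add: mark_tape_def)
  have "init_config vc_tm (encode_graph G) =
      conf (Scan Nought False Before) [] (encode_graph G) 0 {} 0 0"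
    by (auto simp: init_config_def conf_def vc_tm_def code.simps unary_tape_def mark_tape_eq
        fun_eq_iff word_tape_def numeral_2_eq_2)
  hence run: "runs (init_config vc_tm (encode_graph G)) t
      (conf (Scan Nought False Before) (encode_graph G) [] n (leaf_greedy G) (if n = 0 then 0 else n) 0)"
    using run_rows[of "num_verts G" G "[]"]
    by (auto simp add: t_def n_def l_def leaf_greedy_def simp flip: encode_graph_eq)
  have "word_tape (encode_graph G) (int l) = 0"
    by (simp add: word_tape_def l_def)
  moreover have "f(i := 0) = f" if "f i = 0" for f :: "int \<Rightarrow> nat" and i
    using that by auto
  ultimately have "runs (conf (Scan Nought False Before) (encode_graph G) [] n (leaf_greedy G) (if n = 0 then 0 else n) 0)
      1 e"
    unfolding runs_def conf_def m
    using code_less[of "Scan Nought False Before"]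
    by (simp add: vc_tm_def e_def l_def numeral_2_eq_2)
  note halt = runs_trans[OF run this]
  \<comment> \<open>The halting state is required after exactly the given number of steps; a halted
    machine does not move, so the run can be padded.\<close>
  have stay: "runs e j e" for j
    by (induction j) (auto simp: runs_def e_def vc_tm_def)
  \<comment> \<open>\<open>n * (n + 2) \<le> 2 * (n * n + n) \<le> 2 * l\<close>, hence the factor
    3.\<close>
  have "n * n + n \<le> l" using length_encode_graph_ge[of G] by (simp add: n_def l_def)
  hence "t + 1 \<le> 3 * l ^ 1 + 3" by (simp add: t_def algebra_simps)
  then obtain j where j: "3 * l ^ 1 + 3 = (t + 1) + j" using le_Suc_ex by blast
  have "runs (init_config vc_tm (encode_graph G)) (3 * l ^ 1 + 3) e"
    unfolding j by (rule runs_trans[OF halt stay])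
  thus "tm_outputs_within vc_tm (encode_graph G) (3 * length (encode_graph G) ^ 1 + 3)
      (encode_vertex_set (num_verts G) (leaf_greedy G))"
    by (simp add: tm_outputs_within_def runs_def l_def e_def n_def vc_tm_def)
qed

section \<open>Covers found by the greedy rule\<close>

text \<open>Unlike the degree, this counts a loop once; it is the quantity that the machine can read
  off a row.\<close>

definition row_sum :: "multigraph \<Rightarrow> nat \<Rightarrow> nat" where
  "row_sum G u = (\<Sum>v<num_verts G. edge_mult G u v)"

lemma funpow_funpow: "(f ^^ m) ((f ^^ n) x) = (f ^^ (n + m)) x"
  by (subst add.commute) (simp add: funpow_add)

lemma bump_funpow_eq_Several: "(bump ^^ k) Nought = Several \<longleftrightarrow> k \<ge> 2"
proof -
  have *: "bump (bump ((bump ^^ j) Nought)) = Several" for j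
    by (induction j) auto
  show ?thesis
  proof (cases k)
    case (Suc i)
    thus ?thesis using * by (cases i) simp_all
  qed simp
qed

text \<open>Covers the columns left of the diagonal and those scanned after the search has
  ended.\<close>

lemma fold_scan_col_fixed:
  assumes "\<forall>v\<in>set vs. v < u \<or> b = Idle \<or> b = Matched"
  shows "fold (scan_col c u) vs (r, b, X) = ((bump ^^ sum_list (map c vs)) r, b, X)"
  using assms
proof (induction vs arbitrary: r)
  case (Cons v vs)
  have "scan_col c u v (r, b, X) = ((bump ^^ c v) r, b, X)"
    using Cons.prems by (auto simp: scan_col_def)
  with Cons show ?case by (simp add: funpow_funpow)
qed simp

lemma fold_scan_col_Searching:
  assumes "\<forall>v\<in>set vs. u < v"
  shows "\<exists>b Y. fold (scan_col c u) vs (r, Searching, X) = ((bump ^^ sum_list (map c vs)) r, b, Y) \<and>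
     (b = Searching \<and> Y = X \<and> (\<forall>v\<in>set vs. c v > 0 \<longrightarrow> v \<in> X) \<or>
      b = Matched \<and> (\<exists>v\<in>set vs. c v > 0 \<and> v \<notin> X \<and> Y = insert v X))"
  using assms
proof (induction vs arbitrary: r)
  case (Cons v vs)
  show ?case
  proof (cases "c v > 0 \<and> v \<notin> X")
    case True
    hence "scan_col c u v (r, Searching, X) = ((bump ^^ c v) r, Matched, insert v X)"
      using Cons.prems by (auto simp: scan_col_def)
    thus ?thesis using True
      by (auto simp: fold_scan_col_fixed funpow_funpow)
  next
    case False
    hence "scan_col c u v (r, Searching, X) = ((bump ^^ c v) r, Searching, X)"
      using Cons.prems by (auto simp: scan_col_def)
    thus ?thesis using False Cons.IH[of "(bump ^^ c v) r"] Cons.prems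
      by (auto simp: funpow_funpow)
  qed
qed auto

text \<open>The row is split at the diagonal; the tally runs over both halves, so the final test
  sees all edges of \<open>u\<close> and not only those to later vertices. The later arguments use
  the automaton only through these four outcomes.\<close>

lemma scan_row_cases:
  assumes "u < n"
  obtains "u \<in> X" "scan_row n c u X = X"
  | "u \<notin> X" "c u > 0" "scan_row n c u X = insert u X"
  | "u \<notin> X" "c u = 0" "\<forall>v. u < v \<and> v < n \<and> c v > 0 \<longrightarrow> v \<in> X" "scan_row n c u X = X"
  | v where "u \<notin> X" "c u = 0" "u < v" "v < n" "c v > 0" "v \<notin> X"
      "scan_row n c u X = (if (\<Sum>v<n. c v) \<ge> 2 then insert u (insert v X) else insert v X)"
proof -
  have split: "[0..<n] = [0..<u] @ u # [Suc u..<n]"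
    using assms upt_add_eq_append[of 0 u "n - u"] upt_conv_Cons[of u n] by simp
  have sum: "sum_list (map c [0..<n]) = (\<Sum>v<n. c v)"
    by (simp add: interv_sum_list_conv_sum_set_nat atLeast0LessThan)
  have bump: "(bump ^^ sum_list (map c [Suc u..<n])) ((bump ^^ c u)
      ((bump ^^ sum_list (map c [0..<u])) Nought)) = Several \<longleftrightarrow> (\<Sum>v<n. c v) \<ge> 2"
    unfolding sum[symmetric] split bump_funpow_eq_Several[symmetric]
    by (simp add: funpow_funpow ac_simps)
  let ?r = "(bump ^^ sum_list (map c [0..<u])) Nought"
  have start: "fold (scan_col c u) [0..<n] (Nought, Before, X) =
      fold (scan_col c u) [Suc u..<n] (scan_col c u u (?r, Before, X))"
    unfolding split by (simp add: fold_scan_col_fixed)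
  consider "u \<in> X \<or> c u > 0" | "u \<notin> X" "c u = 0" by auto
  thus thesis
  proof cases
    case 1
    hence "scan_row n c u X = (if c u > 0 then insert u X else X)"
      by (auto simp: scan_row_def start scan_col_def fold_scan_col_fixed)
    thus thesis using 1 that(1,2) by (auto simp: insert_absorb split: if_splits)
  next
    case 2
    hence "scan_col c u u (?r, Before, X) = ((bump ^^ c u) ?r, Searching, X)"
      by (simp add: scan_col_def)
    with fold_scan_col_Searching[of "[Suc u..<n]" u c "(bump ^^ c u) ?r" X]
    obtain b Y where bY:
      "fold (scan_col c u) [0..<n] (Nought, Before, X) =
         ((bump ^^ sum_list (map c [Suc u..<n])) ((bump ^^ c u) ?r), b, Y)"
      "b = Searching \<and> Y = X \<and> (\<forall>v\<in>set [Suc u..<n]. c v > 0 \<longrightarrow> v \<in> X) \<or>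
       b = Matched \<and> (\<exists>v\<in>set [Suc u..<n]. c v > 0 \<and> v \<notin> X \<and> Y = insert v X)"
      by (auto simp: start)
    from bY(2) show thesis
    proof (elim disjE conjE bexE)
      assume b: "b = Searching" "Y = X" "\<forall>v\<in>set [Suc u..<n]. c v > 0 \<longrightarrow> v \<in> X"
      hence "scan_row n c u X = X" by (simp add: scan_row_def bY(1))
      thus thesis using 2 b(3) by (intro that(3)) auto
    next
      fix v assume v: "b = Matched" "v \<in> set [Suc u..<n]" "c v > 0" "v \<notin> X" "Y = insert v X"
      hence "scan_row n c u X =
          (if (\<Sum>v<n. c v) \<ge> 2 then insert u (insert v X) else insert v X)"
        using bump by (simp add: scan_row_def bY(1))
      thus thesis using 2 v by (intro that(4)[of v]) auto
    qed
  qed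
qed

section \<open>Growth of the marked set and coverage of the edges\<close>

lemma edge_mult_sym: "edge_mult G u v = edge_mult G v u"
proof -
  have "Upair u v = Upair v u" by simp
  thus ?thesis unfolding edge_mult_def by (rule arg_cong)
qed

lemma leaf_greedy_upto_Suc:
  "leaf_greedy_upto G (Suc k) = scan_row (num_verts G) (edge_mult G k) k (leaf_greedy_upto G k)"
  by (simp add: leaf_greedy_upto_def)

lemma leaf_greedy_upto_subset:
  "k \<le> num_verts G \<Longrightarrow> leaf_greedy_upto G k \<subseteq> {..<num_verts G}"
proof (induction k)
  case (Suc k)
  hence k: "k < num_verts G" by simp
  show ?case
    by (cases rule: scan_row_cases[OF k, of "leaf_greedy_upto G k" "edge_mult G k"])
      (use Suc in \<open>auto simp: leaf_greedy_upto_Suc split: if_splits\<close>)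
qed (simp add: leaf_greedy_upto_def)

lemma leaf_greedy_upto_mono:
  assumes "j \<le> k" "k \<le> num_verts G"
  shows "leaf_greedy_upto G j \<subseteq> leaf_greedy_upto G k"
  using assms
proof (induction k rule: dec_induct)
  case (step k)
  hence k: "k < num_verts G" by simp
  show ?case
    by (cases rule: scan_row_cases[OF k, of "leaf_greedy_upto G k" "edge_mult G k"])
      (use step in \<open>auto simp: leaf_greedy_upto_Suc split: if_splits\<close>)
qed simp

text \<open>An edge is settled in the row of its smaller end \<open>i\<close>, and marks are never
  removed. If \<open>i\<close> takes a partner other than the edge's end \<open>j\<close>, then
  \<open>i\<close> has at least two edges and is marked itself.\<close>

lemma leaf_greedy_upto_covers:
  assumes "k \<le> num_verts G" "u < k" "v < num_verts G" "edge_mult G u v > 0"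
  shows "u \<in> leaf_greedy_upto G k \<or> v \<in> leaf_greedy_upto G k"
proof -
  have *: "i \<in> leaf_greedy_upto G k \<or> j \<in> leaf_greedy_upto G k"
    if i: "i < k" "i \<le> j" "j < num_verts G" "edge_mult G i j > 0" for i j
  proof -
    let ?X = "leaf_greedy_upto G i"
    have n: "i < num_verts G" using i assms(1) by simp
    have "i \<in> leaf_greedy_upto G (Suc i) \<or> j \<in> leaf_greedy_upto G (Suc i)"
    proof (cases rule: scan_row_cases[OF n, of ?X "edge_mult G i"])
      case (4 v)
      show ?thesis
      proof (cases "j = v")
        case False
        have "edge_mult G i v + edge_mult G i j = sum (edge_mult G i) {v, j}" using False by simp
        also have "\<dots> \<le> (\<Sum>v<num_verts G. edge_mult G i v)"
          using 4 i by (intro sum_mono2) auto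
        finally have "(\<Sum>v<num_verts G. edge_mult G i v) \<ge> 2" using 4 i by linarith
        thus ?thesis using 4 by (simp add: leaf_greedy_upto_Suc)
      qed (use 4 in \<open>auto simp: leaf_greedy_upto_Suc\<close>)
    qed (use i in \<open>auto simp: leaf_greedy_upto_Suc le_less\<close>)
    moreover have "leaf_greedy_upto G (Suc i) \<subseteq> leaf_greedy_upto G k"
      using i assms(1) by (intro leaf_greedy_upto_mono) auto
    ultimately show ?thesis by blast
  qed
  show ?thesis
    using *[of u v] *[of v u] assms edge_mult_sym[of G v u] by (cases "u \<le> v") auto
qed

lemma vertex_cover_leaf_greedy:
  assumes "wf_multigraph G"
  shows "vertex_cover G (leaf_greedy G)"
  unfolding vertex_cover_def
proof (intro conjI ballI)
  show "leaf_greedy G \<subseteq> {..<num_verts G}"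
    unfolding leaf_greedy_def by (rule leaf_greedy_upto_subset) simp
  fix e assume e: "e \<in># edges G"
  obtain u v where uv: "e = Upair u v" by (cases e) auto
  hence "u < num_verts G" "v < num_verts G"
    using e assms by (auto simp: wf_multigraph_def)
  moreover have "edge_mult G u v > 0" using e uv by (simp add: edge_mult_def)
  ultimately show "set_uprod e \<inter> leaf_greedy G \<noteq> {}"
    using leaf_greedy_upto_covers[of "num_verts G" G u v] by (auto simp: leaf_greedy_def uv)
qed

lemma poly_time_vc_algorithm_leaf_greedy: "poly_time_vc_algorithm leaf_greedy"
  unfolding poly_time_vc_algorithm_def
  using vertex_cover_leaf_greedy poly_time_computable_leaf_greedy by blast

text \<open>
  The vertices touched up to row \<open>k\<close>: every row that marks something touches two new adjacent
  vertices (or a new vertex with a loop), so that each such row costs any vertex cover a vertex.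
\<close>

definition touched :: "multigraph \<Rightarrow> nat \<Rightarrow> nat set" where
  "touched G k = {..<k} \<union> leaf_greedy_upto G k"

text \<open>Here \<open>a\<close> counts new marks and \<open>b\<close> newly touched vertices of
  \<open>D\<close>. In a marking row, \<open>u\<close> and its partner \<open>v > u\<close> are
  unmarked, hence untouched, and the edge between them (or the loop at \<open>u\<close>) puts one of
  them into \<open>D\<close>. So \<open>b \<ge> 1\<close>, while \<open>a \<le> 2\<close>, and
  \<open>a \<le> 1\<close> if \<open>u\<close> has only one edge.\<close>

lemma leaf_greedy_upto_Suc_bound:
  assumes D: "vertex_cover G D" and u: "u < num_verts G"
  defines "X \<equiv> leaf_greedy_upto G u" and "Y \<equiv> leaf_greedy_upto G (Suc u)"
  shows "Y - X \<subseteq> {u..}"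
    and "\<exists>a b. card Y = card X + a \<and> card (D \<inter> touched G (Suc u)) = card (D \<inter> touched G u) + b \<and>
           a \<le> 2 * b \<and> (row_sum G u \<le> 1 \<longrightarrow> a \<le> b)"
proof -
  have fin: "finite X"
    unfolding X_def by (rule finite_subset[OF leaf_greedy_upto_subset]) (use u in auto)
  have finD: "finite D" using D by (auto simp: vertex_cover_def intro: finite_subset)
  have Y: "Y = scan_row (num_verts G) (edge_mult G u) u X"
    by (simp add: X_def Y_def leaf_greedy_upto_Suc)
  have T: "touched G u = {..<u} \<union> X" "touched G (Suc u) = insert u {..<u} \<union> Y"
    by (simp_all add: touched_def X_def Y_def lessThan_Suc)
  have le: "\<exists>b. card (D \<inter> T') = card (D \<inter> T) + b \<and> (D \<inter> (T' - T) \<noteq> {} \<longrightarrow> b \<ge> 1)"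
    if "T \<subseteq> T'" for T T'
  proof -
    have "D \<inter> T' = (D \<inter> T) \<union> (D \<inter> (T' - T))" using that by blast
    hence "card (D \<inter> T') = card (D \<inter> T) + card (D \<inter> (T' - T))"
      using finD by (subst card_Un_disjoint[symmetric]) auto
    moreover have "D \<inter> (T' - T) \<noteq> {} \<longrightarrow> card (D \<inter> (T' - T)) \<ge> 1"
      using finD by (auto simp: Suc_le_eq card_gt_0_iff)
    ultimately show ?thesis by blast
  qed
  have cover: "u \<in> D \<or> v \<in> D" if "edge_mult G u v > 0" for v
    using D that by (auto simp: vertex_cover_def edge_mult_def)
  show "Y - X \<subseteq> {u..}" unfolding Y
    by (cases rule: scan_row_cases[OF u, of X "edge_mult G u"]) (auto split: if_splits)
  show "\<exists>a b. card Y = card X + a \<and> card (D \<inter> touched G (Suc u)) = card (D \<inter> touched G u) + b \<and>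
           a \<le> 2 * b \<and> (row_sum G u \<le> 1 \<longrightarrow> a \<le> b)"
  proof (cases rule: scan_row_cases[OF u, of X "edge_mult G u"])
    case 1
    hence "Y = X" by (simp add: Y)
    thus ?thesis using le[of "touched G u" "touched G (Suc u)"] T by force
  next
    case 2
    hence "Y = insert u X" "u \<in> D" using cover by (auto simp: Y)
    moreover have "card (insert u X) = card X + 1" using fin 2 by simp
    ultimately show ?thesis using le[of "touched G u" "touched G (Suc u)"] T 2 by force
  next
    case 3
    hence "Y = X" by (simp add: Y)
    thus ?thesis using le[of "touched G u" "touched G (Suc u)"] T by force
  next
    case (4 v)
    have "u \<in> D \<or> v \<in> D" using cover 4 by blast
    hence "D \<inter> (touched G (Suc u) - touched G u) \<noteq> {}"
      unfolding T using 4 by (auto simp: Y split: if_splits)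
    moreover have "card Y = card X + (if row_sum G u \<ge> 2 then 2 else 1)"
      using 4 fin by (simp add: Y row_sum_def)
    moreover have "touched G u \<subseteq> touched G (Suc u)"
      unfolding T using 4 by (auto simp: Y)
    ultimately show ?thesis using le[of "touched G u" "touched G (Suc u)"] by fastforce
  qed
qed

text \<open>For leaves \<open>a \<le> b\<close> holds in every row, and these inequalities add
  up.\<close>

lemma card_leaf_greedy_upto_le_leaves:
  assumes D: "vertex_cover G D" and "k \<le> num_verts G" and "\<And>u. u < k \<Longrightarrow> row_sum G u \<le> 1"
  shows "card (leaf_greedy_upto G k) \<le> card (D \<inter> touched G k)"
  using assms(2,3)
proof (induction k)
  case (Suc k)
  have "card (leaf_greedy_upto G k) \<le> card (D \<inter> touched G k)"
    by (rule Suc.IH) (use Suc.prems in auto)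
  moreover obtain a b where "card (leaf_greedy_upto G (Suc k)) = card (leaf_greedy_upto G k) + a"
    "card (D \<inter> touched G (Suc k)) = card (D \<inter> touched G k) + b" "row_sum G k \<le> 1 \<longrightarrow> a \<le> b"
    using leaf_greedy_upto_Suc_bound(2)[OF D Suc_le_lessD[OF Suc.prems(1)]] by blast
  ultimately show ?case using Suc.prems(2)[of k] by simp
qed (simp add: leaf_greedy_upto_def)

text \<open>After the leaves the marks number at most the touched vertices of \<open>D\<close>;
  doubling this leaves room for a second copy of the leaf-stage marks, and later rows preserve the
  inequality by \<open>a \<le> 2 * b\<close>. For the second bound, later rows mark only vertices
  from \<open>l\<close> on.\<close>

lemma card_leaf_greedy_le:
  assumes D: "vertex_cover G D" and l: "l \<le> num_verts G" "\<And>u. u < l \<Longrightarrow> row_sum G u \<le> 1"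
  shows "card (leaf_greedy G) + card (leaf_greedy_upto G l) \<le> 2 * card D"
    and "card (leaf_greedy G) \<le> card (leaf_greedy_upto G l) + (num_verts G - l)"
proof -
  let ?X = "leaf_greedy_upto G"
  have "card (?X k) + card (?X l) \<le> 2 * card (D \<inter> touched G k) \<and> ?X k - ?X l \<subseteq> {l..}"
    if "l \<le> k" "k \<le> num_verts G" for k
    using that
  proof (induction k rule: dec_induct)
    case base
    thus ?case using card_leaf_greedy_upto_le_leaves[OF D l] by simp
  next
    case (step k)
    obtain a b where "card (?X (Suc k)) = card (?X k) + a"
      "card (D \<inter> touched G (Suc k)) = card (D \<inter> touched G k) + b" "a \<le> 2 * b"
      using leaf_greedy_upto_Suc_bound(2)[OF D Suc_le_lessD[OF step.prems]] by blast
    moreover have "?X (Suc k) - ?X k \<subseteq> {k..}"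
      using leaf_greedy_upto_Suc_bound(1)[OF D Suc_le_lessD[OF step.prems]] .
    moreover have "card (?X k) + card (?X l) \<le> 2 * card (D \<inter> touched G k)" "?X k - ?X l \<subseteq> {l..}"
      using step.IH step.prems by simp_all
    moreover from calculation(4,6) have "?X (Suc k) - ?X l \<subseteq> {l..}" using step.hyps by fastforce
    ultimately show ?case by simp
  qed
  from this[OF l(1) order_refl]
  have 1: "card (leaf_greedy G) + card (?X l) \<le> 2 * card (D \<inter> touched G (num_verts G))"
    and 2: "leaf_greedy G - ?X l \<subseteq> {l..}" by (auto simp: leaf_greedy_def)
  have "finite D" using D by (auto simp: vertex_cover_def intro: finite_subset)
  hence "card (D \<inter> touched G (num_verts G)) \<le> card D" by (intro card_mono) auto
  with 1 show "card (leaf_greedy G) + card (?X l) \<le> 2 * card D" by linarith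
  have sub: "leaf_greedy G \<subseteq> {..<num_verts G}"
    unfolding leaf_greedy_def by (rule leaf_greedy_upto_subset) simp
  have "leaf_greedy G \<subseteq> ?X l \<union> {l..<num_verts G}" using 2 sub by fastforce
  moreover have "finite (?X l)" by (rule finite_subset[OF leaf_greedy_upto_subset[OF l(1)]]) simp
  ultimately have "card (leaf_greedy G) \<le> card (?X l \<union> {l..<num_verts G})"
    by (intro card_mono) auto
  also have "\<dots> \<le> card (?X l) + (num_verts G - l)"
    using card_Un_le[of "?X l" "{l..<num_verts G}"] by simp
  finally show "card (leaf_greedy G) \<le> card (?X l) + (num_verts G - l)" .
qed

text \<open>Every leaf is charged to a marked vertex, itself or its neighbour. A marked leaf
  receives at most two charges, hence \<open>t \<ge> 2\<close>; another marked vertex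
  \<open>x\<close> receives at most \<open>d x\<close>. The excess over \<open>t\<close>, a
  truncated difference, is summed over all non-leaves, marked or not.\<close>

lemma card_leaves_le:
  assumes l: "l \<le> num_verts G" "\<And>u. u < l \<Longrightarrow> row_sum G u = 1"
    and d: "\<And>u. u < num_verts G \<Longrightarrow> row_sum G u \<le> d u" and t: "t \<ge> 2"
  shows "l \<le> t * card (leaf_greedy_upto G l) + (\<Sum>u=l..<num_verts G. d u - t)"
proof -
  let ?X = "leaf_greedy_upto G l" and ?n = "num_verts G"
  let ?N = "\<lambda>x. {u\<in>{..<l}. u = x \<or> edge_mult G u x > 0}"
  have X: "?X \<subseteq> {..<?n}" by (rule leaf_greedy_upto_subset[OF l(1)])
  have fin: "finite ?X" by (rule finite_subset[OF X]) simp
  have card_nbrs: "card {u\<in>{..<?n}. edge_mult G u x > 0} \<le> row_sum G x" for x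
  proof -
    have "card {u\<in>{..<?n}. edge_mult G u x > 0} = (\<Sum>u\<in>{u\<in>{..<?n}. edge_mult G u x > 0}. 1)" by simp
    also have "\<dots> \<le> (\<Sum>u\<in>{u\<in>{..<?n}. edge_mult G u x > 0}. edge_mult G x u)"
      by (intro sum_mono) (auto simp: edge_mult_sym[of G x])
    also have "\<dots> \<le> row_sum G x" unfolding row_sum_def by (intro sum_mono2) auto
    finally show ?thesis .
  qed
  have N: "card (?N x) \<le> t + (if l \<le> x then d x - t else 0)" if x: "x \<in> ?X" for x
  proof (cases "x < l")
    case True
    have "card (?N x) \<le> card (insert x {u\<in>{..<?n}. edge_mult G u x > 0})"
      using l(1) by (intro card_mono) auto
    also have "\<dots> \<le> 1 + row_sum G x" using card_nbrs[of x] by (simp add: card_insert_if)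
    finally show ?thesis using l(2)[OF True] t True by simp
  next
    case False
    have "card (?N x) \<le> card {u\<in>{..<?n}. edge_mult G u x > 0}"
      using l(1) False by (intro card_mono) auto
    also have "\<dots> \<le> d x" using card_nbrs[of x] d[of x] x X by fastforce
    finally show ?thesis using False by simp
  qed
  have "{..<l} \<subseteq> (\<Union>x\<in>?X. ?N x)"
  proof
    fix u assume u: "u \<in> {..<l}"
    hence "(\<Sum>v<?n. edge_mult G u v) \<noteq> 0" using l(2)[of u] by (simp add: row_sum_def)
    then obtain v where v: "v < ?n" "edge_mult G u v > 0" by (metis gr0I lessThan_iff sum.neutral)
    hence "u \<in> ?X \<or> v \<in> ?X" using leaf_greedy_upto_covers[OF l(1), of u v] u by simp
    thus "u \<in> (\<Union>x\<in>?X. ?N x)" using u v by blast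
  qed
  hence "card {..<l} \<le> card (\<Union>x\<in>?X. ?N x)" using fin by (intro card_mono) auto
  also have "\<dots> \<le> (\<Sum>x\<in>?X. card (?N x))" by (rule card_UN_le[OF fin])
  also have "\<dots> \<le> (\<Sum>x\<in>?X. t + (if l \<le> x then d x - t else 0))" by (intro sum_mono N)
  also have "\<dots> = t * card ?X + (\<Sum>x\<in>?X. if l \<le> x then d x - t else 0)"
    by (simp add: sum.distrib)
  also have "(\<Sum>x\<in>?X. if l \<le> x then d x - t else 0) = (\<Sum>x\<in>?X \<inter> {l..}. d x - t)"
    using fin by (simp add: sum.inter_restrict)
  also have "\<dots> \<le> (\<Sum>u=l..<?n. d u - t)" using X by (intro sum_mono2) auto
  finally show ?thesis by simp
qed

section \<open>Degrees in the random multigraph\<close>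

lemma finite_perfect_matching:
  assumes "finite S" "M \<in> perfect_matchings S"
  shows "finite M"
proof (rule finite_subset)
  show "M \<subseteq> (\<lambda>(x, y). Upair x y) ` (S \<times> S)"
  proof
    fix e assume "e \<in> M"
    thus "e \<in> (\<lambda>(x, y). Upair x y) ` (S \<times> S)"
      using assms(2) by (cases e) (force simp: perfect_matchings_def)
  qed
qed (use assms in auto)

lemma wf_graph_of_matching:
  assumes "M \<in> perfect_matchings (vertex_copies ds)"
  shows "wf_multigraph (graph_of_matching (length ds) M)"
proof -
  have "finite M"
    using assms finite_perfect_matching[OF finite_vertex_copies] by blast
  moreover have "set_uprod e \<subseteq> vertex_copies ds" if "e \<in> M" for e
    using assms that by (auto simp: perfect_matchings_def)
  ultimately show ?thesis
    by (fastforce simp: wf_multigraph_def graph_of_matching_def vertex_copies_def uprod.set_map)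
qed

text \<open>\<open>h i\<close> is the matched pair that contains copy \<open>i\<close> of
  \<open>u\<close>, and the row sum is the size of the image of \<open>h\<close>. It falls short of
  the degree exactly when two copies of \<open>u\<close> are matched with each other, which a single
  copy rules out.\<close>

lemma row_sum_graph_of_matching:
  assumes M: "M \<in> perfect_matchings (vertex_copies ds)" and u: "u < length ds"
  shows "row_sum (graph_of_matching (length ds) M) u \<le> ds ! u"
    and "ds ! u = 1 \<Longrightarrow> row_sum (graph_of_matching (length ds) M) u = 1"
proof -
  let ?G = "graph_of_matching (length ds) M"
  let ?E = "\<lambda>v. {e \<in> M. map_uprod fst e = Upair u v}"
  have fin: "finite M" by (rule finite_perfect_matching[OF finite_vertex_copies M])
  have sub: "set_uprod e \<subseteq> vertex_copies ds" if "e \<in> M" for e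
    using M that by (auto simp: perfect_matchings_def)
  have ex1: "\<exists>!e. e \<in> M \<and> (u, i) \<in> set_uprod e" if "i < ds ! u" for i
    using M u that by (auto simp: perfect_matchings_def vertex_copies_def)
  define h where "h i = (THE e. e \<in> M \<and> (u, i) \<in> set_uprod e)" for i
  have h: "h i \<in> M" "(u, i) \<in> set_uprod (h i)" "\<And>e. e \<in> M \<Longrightarrow> (u, i) \<in> set_uprod e \<Longrightarrow> e = h i"
    if "i < ds ! u" for i
    using theI'[OF ex1[OF that]] ex1[OF that] unfolding h_def by auto
  have edge_mult: "edge_mult ?G u v = card (?E v)" for v
  proof -
    have "edge_mult ?G u v = (\<Sum>e\<in>map_uprod fst -` {Upair u v} \<inter> M. 1)"
      using fin by (simp add: edge_mult_def graph_of_matching_def count_image_mset)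
    also have "map_uprod fst -` {Upair u v} \<inter> M = ?E v" by auto
    finally show ?thesis by simp
  qed
  have "row_sum ?G u = (\<Sum>v<length ds. card (?E v))"
    by (simp add: row_sum_def edge_mult) (simp add: graph_of_matching_def)
  also have "\<dots> = card (\<Union>v<length ds. ?E v)"
    using fin by (intro card_UN_disjoint[symmetric]) auto
  also have "(\<Union>v<length ds. ?E v) = h ` {..<ds ! u}"
  proof (intro equalityI subsetI)
    fix e assume "e \<in> (\<Union>v<length ds. ?E v)"
    then obtain v where e: "e \<in> M" "map_uprod fst e = Upair u v" by auto
    hence "u \<in> fst ` set_uprod e" by (metis uprod.set_map set_uprod_simps insertI1)
    then obtain i where i: "(u, i) \<in> set_uprod e" by auto
    moreover have "i < ds ! u" using sub[OF e(1)] i by (auto simp: vertex_copies_def)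
    ultimately show "e \<in> h ` {..<ds ! u}" using h(3)[OF _ e(1)] by blast
  next
    fix e assume "e \<in> h ` {..<ds ! u}"
    then obtain i where i: "i < ds ! u" "e = h i" by auto
    obtain x y where xy: "e = Upair x y" by (cases e) auto
    have "e \<in> M" "(u, i) \<in> set_uprod e" using i h(1,2) by simp_all
    hence "x \<in> vertex_copies ds" "y \<in> vertex_copies ds" "(u, i) \<in> {x, y}"
      using sub[of e] xy by auto
    hence "(fst x = u \<and> fst y < length ds) \<or> (fst y = u \<and> fst x < length ds)"
      by (auto simp: vertex_copies_def)
    moreover have "map_uprod fst e = Upair (fst x) (fst y)" "Upair (fst x) (fst y) = Upair (fst y) (fst x)"
      by (simp_all add: xy)
    moreover have "e \<in> M" using i h(1) by simp
    ultimately show "e \<in> (\<Union>v<length ds. ?E v)" by (metis (mono_tags, lifting) UN_I lessThan_iff mem_Collect_eq)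
  qed
  finally have row_sum: "row_sum ?G u = card (h ` {..<ds ! u})" .
  thus "row_sum ?G u \<le> ds ! u" using card_image_le[of "{..<ds ! u}" h] by simp
  show "row_sum ?G u = 1" if "ds ! u = 1" using row_sum that by (simp add: lessThan_Suc)
qed

definition inner_degrees :: "real \<Rightarrow> real \<Rightarrow> nat list" where
  "inner_degrees \<alpha> \<beta> =
     concat (map (\<lambda>i. replicate (base_count \<alpha> \<beta> i) i) [2..<Suc (max_degree \<alpha> \<beta>)])"

text \<open>Vertices are numbered by increasing degree, so the leaves form an initial segment and
  come first in the greedy order; the parity correction affects only this segment.\<close>

lemma degree_list_eq:
  assumes "\<alpha> > 0" "\<beta> > 0"
  shows "degree_list \<alpha> \<beta> = replicate (degree_count \<alpha> \<beta> 1) 1 @ inner_degrees \<alpha> \<beta>"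
proof -
  have "exp (\<alpha> / \<beta>) \<ge> 1" using assms by simp
  hence "1 \<le> \<lfloor>exp (\<alpha> / \<beta>)\<rfloor>" by linarith
  hence "1 < Suc (max_degree \<alpha> \<beta>)" unfolding max_degree_def by linarith
  hence "[1..<Suc (max_degree \<alpha> \<beta>)] = 1 # [2..<Suc (max_degree \<alpha> \<beta>)]"
    by (simp only: upt_conv_Cons) (simp add: numeral_2_eq_2)
  moreover have "map (\<lambda>i. replicate (degree_count \<alpha> \<beta> i) i) [2..<Suc (max_degree \<alpha> \<beta>)] =
      map (\<lambda>i. replicate (base_count \<alpha> \<beta> i) i) [2..<Suc (max_degree \<alpha> \<beta>)]"
    by (intro map_cong) (auto simp: degree_count_def)
  ultimately show ?thesis
    by (simp only: degree_list_def inner_degrees_def list.map concat.simps)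
qed

lemma sum_list_map_inner_degrees:
  "sum_list (map f (inner_degrees \<alpha> \<beta>)) = (\<Sum>i = 2..max_degree \<alpha> \<beta>. base_count \<alpha> \<beta> i * f i)"
proof -
  have "sum_list (map f (concat (map (\<lambda>i. replicate (g i) i) xs))) = (\<Sum>i\<leftarrow>xs. g i * f i)"
    for xs :: "nat list" and f g :: "nat \<Rightarrow> nat"
    by (induction xs) (auto simp: sum_list_replicate)
  thus ?thesis
    unfolding inner_degrees_def
    by (simp add: sum_list_distinct_conv_sum_set atLeastLessThanSuc_atLeastAtMost del: upt_Suc)
qed

lemma base_count_le:
  assumes "i \<ge> 1"
  shows "real (base_count \<alpha> \<beta> i) \<le> exp \<alpha> * real i powr (- \<beta>)"
proof -
  have "real (base_count \<alpha> \<beta> i) \<le> exp \<alpha> / real i powr \<beta>"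
    unfolding base_count_def by (intro of_nat_floor) auto
  thus ?thesis by (simp add: powr_minus divide_inverse)
qed

lemma degree_count_1_ge: "real (degree_count \<alpha> \<beta> 1) \<ge> exp \<alpha> - 1"
proof -
  have "exp \<alpha> - 1 \<le> real (nat \<lfloor>exp \<alpha>\<rfloor>)" by linarith
  moreover have "base_count \<alpha> \<beta> 1 = nat \<lfloor>exp \<alpha>\<rfloor>" by (simp add: base_count_def)
  moreover from this have "degree_count \<alpha> \<beta> 1 \<ge> nat \<lfloor>exp \<alpha>\<rfloor>"
    by (simp add: degree_count_def)
  ultimately show ?thesis by linarith
qed

section \<open>Numerical estimates\<close>

text \<open>Convexity in terms of the tangent at \<open>x\<close>, from
  \<open>ln z \<le> z - 1\<close> and \<open>1 + z \<le> exp z\<close>.\<close>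

lemma powr_tangent:
  fixes x y p :: real
  assumes "x > 0" "y > 0" "p \<le> 0"
  shows "y powr p \<ge> x powr p * (1 + p * (y / x - 1))"
proof -
  have "ln (y / x) \<le> y / x - 1" using assms by (intro ln_le_minus_one) auto
  hence "p * (y / x - 1) \<le> p * ln (y / x)" using assms by (intro mult_left_mono_neg)
  also have "1 + p * ln (y / x) \<le> (y / x) powr p"
    using exp_ge_add_one_self[of "p * ln (y / x)"] assms by (simp add: powr_def)
  finally have "x powr p * (1 + p * (y / x - 1)) \<le> x powr p * (y / x) powr p"
    by (intro mult_left_mono) auto
  also have "\<dots> = y powr p" using assms by (simp flip: powr_mult)
  finally show ?thesis .
qed

text \<open>The midpoint rule underestimates the integral of a convex function.\<close>

lemma powr_midpoint:
  fixes x s :: real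
  assumes "x > 1 / 2" "s > 0"
  shows "s * x powr (- s - 1) \<le> (x - 1 / 2) powr (- s) - (x + 1 / 2) powr (- s)"
proof -
  \<comment> \<open>\<open>g 0 = 0\<close>, and the claim is \<open>g (1 / 2) \<ge> 0\<close>. The
    derivative is nonnegative because the tangent at \<open>x\<close> bounds the values at
    \<open>x - t\<close> and \<open>x + t\<close> from below.\<close>
  define g where
    "g t = (x - t) powr (- s) - (x + t) powr (- s) - 2 * s * t * x powr (- s - 1)" for t
  have "g 0 \<le> g (1 / 2)"
  proof (rule DERIV_nonneg_imp_nondecreasing[where f = g])
    fix t :: real assume t: "0 \<le> t" "t \<le> 1 / 2"
    let ?D = "s * (x - t) powr (- s - 1) + s * (x + t) powr (- s - 1) - 2 * s * x powr (- s - 1)"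
    have "(g has_real_derivative ?D) (at t)"
      unfolding g_def using assms t
      by (auto intro!: derivative_eq_intros simp: algebra_simps)
    moreover have "x powr (- s - 1) * (1 + (- s - 1) * ((x - t) / x - 1)) +
        x powr (- s - 1) * (1 + (- s - 1) * ((x + t) / x - 1)) = 2 * x powr (- s - 1)"
      using assms by (simp add: field_simps)
    hence "2 * x powr (- s - 1) \<le> (x - t) powr (- s - 1) + (x + t) powr (- s - 1)"
      using powr_tangent[of x "x - t" "- s - 1"] powr_tangent[of x "x + t" "- s - 1"] assms t by simp
    hence "s * (2 * x powr (- s - 1)) \<le> s * ((x - t) powr (- s - 1) + (x + t) powr (- s - 1))"
      using assms by (intro mult_left_mono) auto
    hence "?D \<ge> 0" by (simp add: algebra_simps)
    ultimately show "\<exists>y. (g has_real_derivative y) (at t) \<and> y \<ge> 0" by blast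
  qed simp
  thus ?thesis by (simp add: g_def)
qed

text \<open>The midpoint bounds telescope. The shift \<open>c\<close> is there because summing twice
  leads to half-integers.\<close>

lemma sum_powr_le:
  fixes c s :: real
  assumes "s > 0" "real m - c > 1 / 2"
  shows "(\<Sum>d = m..D. (real d - c) powr (- s - 1)) \<le> (real m - c - 1 / 2) powr (- s) / s"
proof -
  have "s * (\<Sum>d = m..D. (real d - c) powr (- s - 1)) \<le>
      (real m - c - 1 / 2) powr (- s) - (real D - c + 1 / 2) powr (- s)" if "m \<le> D"
    using that
  proof (induction D rule: dec_induct)
    case base
    show ?case using powr_midpoint[of "real m - c" s] assms by (simp add: algebra_simps)
  next
    case (step D)
    have "s * (real (Suc D) - c) powr (- s - 1) \<le>
        (real D - c + 1 / 2) powr (- s) - (real (Suc D) - c + 1 / 2) powr (- s)"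
      using powr_midpoint[of "real (Suc D) - c" s] assms step.hyps by (simp add: algebra_simps)
    thus ?case using step by (simp add: algebra_simps)
  qed
  moreover have "(real D - c + 1 / 2) powr (- s) \<ge> 0" by simp
  ultimately have "s * (\<Sum>d = m..D. (real d - c) powr (- s - 1)) \<le> (real m - c - 1 / 2) powr (- s)"
    by (cases "m \<le> D") (linarith, simp)
  thus ?thesis using assms by (simp add: field_simps)
qed

text \<open>The weight \<open>d - m + 1\<close> is the number of \<open>j\<close> from
  \<open>m\<close> to \<open>d\<close>. After exchanging the sums, the midpoint bound applies twice,
  with \<open>c = 0\<close> inside and \<open>c = 1 / 2\<close> outside.\<close>

lemma sum_weighted_powr_le:
  fixes b :: real
  assumes "b > 2" "m \<ge> 2"
  shows "(\<Sum>d = m..D. (real d - real m + 1) * real d powr (- b)) \<le>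
    (real m - 1) powr (2 - b) / ((b - 1) * (b - 2))"
proof -
  have "(\<Sum>d = m..D. (real d - real m + 1) * real d powr (- b)) =
      (\<Sum>d\<in>{m..D}. \<Sum>j\<in>{j\<in>{m..D}. j \<le> d}. real d powr (- b))"
  proof (intro sum.cong refl)
    fix d assume d: "d \<in> {m..D}"
    hence "{j\<in>{m..D}. j \<le> d} = {m..d}" by auto
    thus "(real d - real m + 1) * real d powr (- b) = (\<Sum>j\<in>{j\<in>{m..D}. j \<le> d}. real d powr (- b))"
      using d by (simp add: of_nat_diff)
  qed
  also have "\<dots> = (\<Sum>j\<in>{m..D}. \<Sum>d\<in>{d\<in>{m..D}. j \<le> d}. real d powr (- b))"
    by (rule sum.swap_restrict) auto
  also have "\<dots> \<le> (\<Sum>j = m..D. (real j - 1 / 2) powr (- (b - 2) - 1) / (b - 1))"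
  proof (intro sum_mono)
    fix j assume j: "j \<in> {m..D}"
    hence "{d\<in>{m..D}. j \<le> d} = {j..D}" by auto
    thus "(\<Sum>d\<in>{d\<in>{m..D}. j \<le> d}. real d powr (- b)) \<le> (real j - 1 / 2) powr (- (b - 2) - 1) / (b - 1)"
      using sum_powr_le[of "b - 1" j 0 D] assms j by (simp add: algebra_simps)
  qed
  also have "\<dots> = (\<Sum>j = m..D. (real j - 1 / 2) powr (- (b - 2) - 1)) / (b - 1)"
    by (simp add: sum_divide_distrib)
  also have "\<dots> \<le> ((real m - 1) powr (2 - b) / (b - 2)) / (b - 1)"
    using sum_powr_le[of "b - 2" m "1 / 2" D] assms
    by (intro divide_right_mono) (auto simp: algebra_simps)
  finally show ?thesis using assms by (simp add: mult.commute)
qed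

section \<open>Explicit constants\<close>

lemma le_powr_divide:
  fixes x c :: real
  assumes "x > 0" "c \<ge> 0" "n > 0" "c ^ n \<le> x ^ m"
  shows "c \<le> x powr (real m / real n)"
proof -
  have "(x powr (real m / real n)) ^ n = x ^ m"
    using assms by (simp add: powr_power powr_realpow)
  hence "c ^ n \<le> (x powr (real m / real n)) ^ n" using assms by simp
  thus ?thesis using assms by (simp add: power_mono_iff)
qed

text \<open>The exponents are fractions with small denominators just above \<open>- b\<close>,
  \<open>1 - b\<close> and \<open>3 * (2 - b)\<close> at \<open>b = 2.424\<close>; so each bound
  reduces to comparing integer powers of rationals.\<close>

lemma powr_numerics:
  "2 powr (- (12 / 5)) \<le> (1896 / 10000 :: real)"
  "(5 / 2) powr (- (7 / 5)) \<le> (2774 / 10000 :: real)"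
  "2 powr (- (5 / 4)) \<le> (4205 / 10000 :: real)"
proof -
  have "10000 / 1896 \<le> (2::real) powr (real 12 / real 5)"
    by (rule le_powr_divide) (simp_all add: power_divide divide_simps)
  moreover have "10000 / 2774 \<le> (5 / 2 :: real) powr (real 7 / real 5)"
    by (rule le_powr_divide) (simp_all add: power_divide divide_simps)
  moreover have "10000 / 4205 \<le> (2::real) powr (real 5 / real 4)"
    by (rule le_powr_divide) (simp_all add: power_divide divide_simps)
  ultimately show
    "2 powr (- (12 / 5)) \<le> (1896 / 10000 :: real)"
    "(5 / 2) powr (- (7 / 5)) \<le> (2774 / 10000 :: real)"
    "2 powr (- (5 / 4)) \<le> (4205 / 10000 :: real)"
    by (simp_all add: powr_minus field_simps)
qed

text \<open>All terms decrease in \<open>b\<close>, so rounding at 2.424 suffices: the two summands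
  are below 0.300 and 0.697. Relative to \<open>exp \<alpha>\<close>, \<open>p + \<tau>\<close> will
  bound the number of non-leaves and the last term their degree excess over 8.\<close>

lemma numeric_gap:
  fixes b :: real
  assumes b: "b > 2.424"
  defines "p \<equiv> 2 powr (- b)" and "\<tau> \<equiv> (5 / 2) powr (1 - b) / (b - 1)"
  shows "4 * \<tau> * (p + \<tau>) + 8 powr (2 - b) / ((b - 1) * (b - 2)) < 1"
proof -
  have "p \<le> 2 powr (- (12 / 5))" unfolding p_def using b by (intro powr_mono) auto
  hence "p \<le> 1896 / 10000" using powr_numerics(1) by linarith
  moreover have "0 \<le> p" by (simp add: p_def)
  ultimately have p: "0 \<le> p" "p \<le> 1896 / 10000" by simp_all
  have "\<tau> \<le> (2774 / 10000) / (1424 / 1000)"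
    unfolding \<tau>_def
  proof (rule frac_le)
    have "(5 / 2) powr (1 - b) \<le> (5 / 2 :: real) powr (- (7 / 5))" using b by (intro powr_mono) auto
    thus "(5 / 2) powr (1 - b) \<le> 2774 / 10000" using powr_numerics(2) by linarith
  qed (use b in auto)
  hence \<tau>: "0 \<le> \<tau>" "\<tau> \<le> 1949 / 10000" using b by (auto simp: \<tau>_def)
  have "8 powr (2 - b) / ((b - 1) * (b - 2)) \<le> (4205 / 10000) / (1424 / 1000 * (424 / 1000))"
  proof (rule frac_le)
    have "8 powr (2 - b) = (2 :: real) powr (3 * (2 - b))"
      using powr_powr[of 2 3 "2 - b"] by simp
    also have "\<dots> \<le> 2 powr (- (5 / 4))" using b by (intro powr_mono) auto
    finally show "8 powr (2 - b) \<le> 4205 / 10000" using powr_numerics(3) by linarith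
    show "1424 / 1000 * (424 / 1000) \<le> (b - 1) * (b - 2)" using b by (intro mult_mono) auto
  qed auto
  moreover have "\<tau> * (p + \<tau>) \<le> 1949 / 10000 * (1896 / 10000 + 1949 / 10000)"
    using p \<tau> by (intro mult_mono add_mono) auto
  ultimately show ?thesis by simp
qed

section \<open>The zeta function and the target ratio\<close>

lemma zeta_term: "1 / real (Suc n) powr s = real (Suc n) powr (- s)"
  by (simp add: powr_minus_divide)

lemma summable_zeta:
  assumes "s > 1"
  shows "summable (\<lambda>n. 1 / real (Suc n) powr s)"
proof -
  have "summable (\<lambda>n. real n powr (- s))" using assms by (simp add: summable_real_powr_iff)
  hence "summable (\<lambda>n. real (Suc n) powr (- s))" by (subst summable_Suc_iff)
  thus ?thesis unfolding zeta_term .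
qed

lemma zeta_ge:
  assumes "s > 1"
  shows "zeta s \<ge> 1 + 1 / 2 powr s"
proof -
  have "(\<Sum>n<2. 1 / real (Suc n) powr s) \<le> zeta s"
    unfolding zeta_def by (intro sum_le_suminf summable_zeta assms) auto
  thus ?thesis by (simp add: numeral_2_eq_2)
qed

text \<open>The terms from 3 on are estimated by the midpoint rule, which starts the integral at
  \<open>5 / 2\<close>; the last summand is the \<open>\<tau>\<close> of
  \<open>numeric_gap\<close>.\<close>

lemma zeta_le:
  assumes "s > 1"
  shows "zeta s \<le> 1 + 1 / 2 powr s + (5 / 2) powr (1 - s) / (s - 1)"
  unfolding zeta_def
proof (rule suminf_le_const[OF summable_zeta[OF assms]])
  fix N
  have "(\<Sum>n<N. 1 / real (Suc n) powr s) \<le> (\<Sum>n<N + 2. 1 / real (Suc n) powr s)"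
    by (intro sum_mono2) auto
  also have "\<dots> = (\<Sum>d = 1..N + 2. real d powr (- s))"
    unfolding zeta_term by (rule sum.reindex_bij_witness[of _ "\<lambda>d. d - 1" Suc]) auto
  also have "\<dots> = 1 + 2 powr (- s) + (\<Sum>d = 3..N + 2. real d powr (- s))"
  proof -
    have "{1..N + 2} = insert 1 (insert 2 {3..N + 2})" by auto
    thus ?thesis by simp
  qed
  also have "(\<Sum>d = 3..N + 2. real d powr (- s)) \<le> (5 / 2) powr (1 - s) / (s - 1)"
    using sum_powr_le[of "s - 1" 3 0 "N + 2"] assms by simp
  finally show "(\<Sum>n<N. 1 / real (Suc n) powr s) \<le> 1 + 1 / 2 powr s + (5 / 2) powr (1 - s) / (s - 1)"
    by (simp add: powr_minus_divide)
qed

text \<open>\<open>zeta (b - 1)\<close> cancels in the fraction and the cubic bracket is at most 1,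
  so the amount subtracted from 2 is at most \<open>1 - (1 + p) / zeta b\<close>, which grows with
  \<open>zeta b\<close>.\<close>

lemma rho'_ge:
  assumes b: "b > 2"
  defines "p \<equiv> 2 powr (- b)" and "\<tau> \<equiv> (5 / 2) powr (1 - b) / (b - 1)"
  shows "2 - \<tau> / (1 + p + \<tau>) \<le> rho' b"
proof -
  have p: "1 / 2 powr b = p" "p > 0" by (simp_all add: p_def powr_minus_divide)
  have z: "1 + p \<le> zeta b" "zeta b \<le> 1 + p + \<tau>"
    using zeta_ge[of b] zeta_le[of b] b by (simp_all add: p \<tau>_def)
  define z' where "z' = zeta (b - 1)"
  define r where "r = (z' - (1 + 1 / 2 powr (b - 1))) / z'"
  have z': "1 + 1 / 2 powr (b - 1) \<le> z'" unfolding z'_def using b by (intro zeta_ge) auto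
  have pos: "0 < 1 + 1 / 2 powr (b - 1)" by (intro add_pos_nonneg) auto
  have r: "0 \<le> r" "r \<le> 1" unfolding r_def using z' pos by (simp_all add: divide_le_eq)
  define q where "q = (zeta b - 1 - p) / zeta b"
  have q: "q \<ge> 0" using z p by (simp add: q_def)
  have "rho' b = 2 - q * (1 - r ^ 3)"
    using z' pos unfolding rho'_def q_def r_def p z'_def[symmetric] by simp
  moreover have "q * (1 - r ^ 3) \<le> q * 1" using q r by (intro mult_left_mono) auto
  moreover have "q \<le> \<tau> / (1 + p + \<tau>)"
  proof -
    have "(1 + p) / (1 + p + \<tau>) \<le> (1 + p) / zeta b" using z p by (intro divide_left_mono) auto
    moreover have "q = 1 - (1 + p) / zeta b" using z p by (simp add: q_def field_simps)
    moreover have "\<tau> / (1 + p + \<tau>) = 1 - (1 + p) / (1 + p + \<tau>)" using z p by (simp add: field_simps)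
    ultimately show ?thesis by simp
  qed
  ultimately show ?thesis by linarith
qed

section \<open>The approximation ratio of the greedy rule\<close>

text \<open>Transfers the counting to the model: sums over the vertices from \<open>l\<close> on
  become sums over the degrees from 2 on, for each graph in the support.\<close>

lemma leaf_greedy_power_law_graph:
  assumes "\<alpha> > 0" "\<beta> > 0" and G: "G \<in> set_pmf (power_law_graph \<alpha> \<beta>)"
  defines "l \<equiv> degree_count \<alpha> \<beta> 1" and "\<Delta> \<equiv> max_degree \<alpha> \<beta>"
  shows "wf_multigraph G"
    and "t \<ge> 2 \<Longrightarrow> l \<le> t * card (leaf_greedy_upto G l) + (\<Sum>i = 2..\<Delta>. base_count \<alpha> \<beta> i * (i - t))"
    and "card (leaf_greedy G) \<le> card (leaf_greedy_upto G l) + (\<Sum>i = 2..\<Delta>. base_count \<alpha> \<beta> i)"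
    and "vertex_cover G D \<Longrightarrow> card (leaf_greedy G) + card (leaf_greedy_upto G l) \<le> 2 * card D"
proof -
  define ds where "ds = degree_list \<alpha> \<beta>"
  define rest where "rest = inner_degrees \<alpha> \<beta>"
  have ds: "ds = replicate l 1 @ rest"
    unfolding ds_def rest_def l_def by (rule degree_list_eq[OF assms(1,2)])
  obtain M where M: "M \<in> perfect_matchings (vertex_copies ds)" "G = graph_of_matching (length ds) M"
    using G unfolding set_pmf_power_law_graph[OF assms(1,2)] ds_def by blast
  show "wf_multigraph G" unfolding M(2) by (rule wf_graph_of_matching[OF M(1)])
  then have cover: "vertex_cover G (leaf_greedy G)" by (rule vertex_cover_leaf_greedy)
  have n: "num_verts G = length ds" by (simp add: M(2) graph_of_matching_def)
  have le: "l \<le> num_verts G" by (simp add: n ds)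
  have row_sum: "row_sum G u \<le> ds ! u" if "u < num_verts G" for u
    using row_sum_graph_of_matching(1)[OF M(1)] that by (simp add: n M(2)[symmetric])
  have leaf: "row_sum G u = 1" if "u < l" for u
    using row_sum_graph_of_matching(2)[OF M(1), of u] that
    by (simp add: M(2)[symmetric]) (simp add: ds nth_append)
  hence leaf': "row_sum G u \<le> 1" if "u < l" for u using that by simp
  have rest: "(\<Sum>u = l..<num_verts G. f (ds ! u)) = (\<Sum>i = 2..\<Delta>. base_count \<alpha> \<beta> i * f i)" for f
  proof -
    have "(\<Sum>u = l..<num_verts G. f (ds ! u)) = (\<Sum>j<length rest. f (rest ! j))"
      by (rule sum.reindex_bij_witness[of _ "\<lambda>j. j + l" "\<lambda>u. u - l"]) (auto simp: n ds nth_append)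
    also have "\<dots> = sum_list (map f rest)"
      by (simp add: sum_list_sum_nth atLeast0LessThan)
    finally show ?thesis by (simp add: rest_def \<Delta>_def sum_list_map_inner_degrees)
  qed
  show "t \<ge> 2 \<Longrightarrow> l \<le> t * card (leaf_greedy_upto G l) + (\<Sum>i = 2..\<Delta>. base_count \<alpha> \<beta> i * (i - t))"
    using card_leaves_le[OF le leaf row_sum, of t] rest[of "\<lambda>d. d - t"] by simp
  show "card (leaf_greedy G) \<le> card (leaf_greedy_upto G l) + (\<Sum>i = 2..\<Delta>. base_count \<alpha> \<beta> i)"
    using card_leaf_greedy_le(2)[OF cover le leaf'] rest[of "\<lambda>_. 1"] by simp
  show "vertex_cover G D \<Longrightarrow> card (leaf_greedy G) + card (leaf_greedy_upto G l) \<le> 2 * card D"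
    using card_leaf_greedy_le(1)[OF _ le leaf'] by blast
qed

lemma min_vc_size_attained:
  assumes "wf_multigraph G"
  obtains D where "vertex_cover G D" "min_vc_size G = card D"
proof -
  have "{C. vertex_cover G C} \<subseteq> Pow {..<num_verts G}" by (auto simp: vertex_cover_def)
  hence "finite {C. vertex_cover G C}" by (rule finite_subset) simp
  moreover have "leaf_greedy G \<in> {C. vertex_cover G C}"
    using vertex_cover_leaf_greedy[OF assms] by simp
  ultimately have "min_vc_size G \<in> card ` {C. vertex_cover G C}"
    unfolding min_vc_size_def by (intro Min_in) auto
  thus thesis using that by auto
qed

text \<open>By \<open>large\<close>, the gap of \<open>numeric_gap\<close> absorbs the loss of at
  most one leaf through rounding.\<close>

lemma approx_ratio_leaf_greedy_le:
  fixes \<beta> :: real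
  assumes \<beta>: "\<beta> > 2.424" and "\<alpha> > 0" and G: "G \<in> set_pmf (power_law_graph \<alpha> \<beta>)"
  defines "p \<equiv> 2 powr (- \<beta>)" and "\<tau> \<equiv> (5 / 2) powr (1 - \<beta>) / (\<beta> - 1)"
    and "B \<equiv> 8 powr (2 - \<beta>) / ((\<beta> - 1) * (\<beta> - 2))"
  assumes large: "exp \<alpha> * (1 - B - 4 * \<tau> * (p + \<tau>)) \<ge> 1"
  shows "approx_ratio leaf_greedy G \<le> rho' \<beta>"
proof -
  have "\<beta> > 0" "\<beta> > 1" "\<beta> > 2" using \<beta> by simp_all
  note L = leaf_greedy_power_law_graph[OF \<open>\<alpha> > 0\<close> \<open>\<beta> > 0\<close> G]
  define X where "X = real (card (leaf_greedy_upto G (degree_count \<alpha> \<beta> 1)))"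
  define C where "C = real (card (leaf_greedy G))"
  define N where "N = (\<Sum>i = 2..max_degree \<alpha> \<beta>. real (base_count \<alpha> \<beta> i))"
  define W where "W = (\<Sum>i = 2..max_degree \<alpha> \<beta>. real (base_count \<alpha> \<beta> i) * real (i - 8))"
  obtain D where D: "vertex_cover G D" "min_vc_size G = card D"
    using min_vc_size_attained[OF L(1)] by blast
  have pos: "0 < p" "0 < \<tau>" using \<open>\<beta> > 1\<close> by (simp_all add: p_def \<tau>_def)
  have N: "N \<le> exp \<alpha> * (p + \<tau>)"
  proof -
    have "N \<le> (\<Sum>i = 2..max_degree \<alpha> \<beta>. exp \<alpha> * real i powr (- \<beta>))"
      unfolding N_def by (intro sum_mono base_count_le) auto
    also have "\<dots> = exp \<alpha> * (\<Sum>i = 2..max_degree \<alpha> \<beta>. real i powr (- \<beta>))"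
      by (simp add: sum_distrib_left)
    \<comment> \<open>The maximum degree may be below 2, so inserting 2 gives only an upper
      bound.\<close>
    also have "(\<Sum>i = 2..max_degree \<alpha> \<beta>. real i powr (- \<beta>)) \<le>
        (\<Sum>i\<in>insert 2 {3..max_degree \<alpha> \<beta>}. real i powr (- \<beta>))"
      by (intro sum_mono2) auto
    also have "\<dots> = p + (\<Sum>i = 3..max_degree \<alpha> \<beta>. real i powr (- \<beta>))"
      by (simp add: p_def)
    also have "(\<Sum>i = 3..max_degree \<alpha> \<beta>. real i powr (- \<beta>)) \<le> \<tau>"
      using sum_powr_le[of "\<beta> - 1" 3 0 "max_degree \<alpha> \<beta>"] \<open>\<beta> > 1\<close> by (simp add: \<tau>_def)
    finally show ?thesis by simp
  qed
  have W: "W \<le> exp \<alpha> * B"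
  proof -
    have "W \<le> (\<Sum>i = 2..max_degree \<alpha> \<beta>. exp \<alpha> * real i powr (- \<beta>) * real (i - 8))"
      unfolding W_def by (intro sum_mono mult_right_mono base_count_le) auto
    also have "\<dots> = exp \<alpha> * (\<Sum>i = 2..max_degree \<alpha> \<beta>. real i powr (- \<beta>) * real (i - 8))"
      by (simp add: sum_distrib_left mult.assoc)
    \<comment> \<open>The truncated difference \<open>i - 8\<close> vanishes up to degree 8.\<close>
    also have "(\<Sum>i = 2..max_degree \<alpha> \<beta>. real i powr (- \<beta>) * real (i - 8)) =
        (\<Sum>i = 9..max_degree \<alpha> \<beta>. (real i - real 9 + 1) * real i powr (- \<beta>))"
      by (intro sum.mono_neutral_cong_right) auto
    also have "\<dots> \<le> B"
      using sum_weighted_powr_le[of \<beta> 9 "max_degree \<alpha> \<beta>"] \<open>\<beta> > 2\<close> by (simp add: B_def)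
    finally show ?thesis by simp
  qed
  \<comment> \<open>Threshold \<open>t = 8\<close>: a larger one shrinks \<open>W\<close> but raises
    the factor of \<open>X\<close>.\<close>
  have "real (degree_count \<alpha> \<beta> 1) \<le> 8 * X + W"
    using of_nat_mono[where 'a = real, OF L(2)[of 8]] by (simp add: X_def W_def)
  hence "exp \<alpha> - 1 - exp \<alpha> * B \<le> 8 * X"
    using degree_count_1_ge[of \<alpha> \<beta>] W by linarith
  hence X: "4 * \<tau> * (exp \<alpha> * (p + \<tau>)) \<le> 8 * X"
    using large by (simp add: algebra_simps)
  have "4 * \<tau> * N \<le> 4 * \<tau> * (exp \<alpha> * (p + \<tau>))"
    using N pos by (intro mult_left_mono) auto
  with X have \<tau>N: "\<tau> * N \<le> 2 * X" by linarith
  \<comment> \<open>By \<open>rho'_ge\<close> it suffices to improve on 2 by this amount.\<close>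
  define \<delta> where "\<delta> = \<tau> / (1 + p + \<tau>)"
  have \<delta>: "\<delta> * N \<le> 2 * (1 - \<delta>) * X"
  proof -
    have "X \<ge> 0" by (simp add: X_def)
    hence "2 * X \<le> 2 * (1 + p) * X" using pos by (intro mult_right_mono) auto
    with \<tau>N have "\<tau> * N \<le> 2 * (1 + p) * X" by linarith
    hence "\<tau> * N / (1 + p + \<tau>) \<le> 2 * (1 + p) * X / (1 + p + \<tau>)"
      using pos by (intro divide_right_mono) auto
    moreover have "1 - \<delta> = (1 + p) / (1 + p + \<tau>)"
      using pos by (simp add: \<delta>_def field_simps)
    ultimately show ?thesis by (simp add: \<delta>_def)
  qed
  have \<delta>01: "0 \<le> \<delta>" "\<delta> \<le> 1" using pos by (simp_all add: \<delta>_def)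
  have CX: "C \<le> X + N" using of_nat_mono[where 'a = real, OF L(3)]
    by (simp add: C_def X_def N_def)
  have CD: "C + X \<le> 2 * real (card D)" using L(4)[OF D(1)] unfolding C_def X_def by simp
  \<comment> \<open>The two bounds on \<open>C\<close> are added with weights
    \<open>\<delta>\<close> and \<open>2 - \<delta>\<close>. What remains of \<open>X\<close> and
    \<open>N\<close> is \<open>\<delta> * N - 2 * (1 - \<delta>) * X\<close>, which is at most
    0.\<close>
  have "\<delta> * C \<le> \<delta> * (X + N)" using CX \<delta>01 by (intro mult_left_mono)
  moreover have "(2 - \<delta>) * (C + X) \<le> (2 - \<delta>) * (2 * real (card D))"
    using CD \<delta>01 by (intro mult_left_mono) auto
  ultimately have "C \<le> (2 - \<delta>) * real (card D)" using \<delta> by (simp add: algebra_simps)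
  \<comment> \<open>If the optimum is empty, division by zero makes the ratio 0.\<close>
  hence "approx_ratio leaf_greedy G \<le> 2 - \<delta>"
    using \<delta>01 by (cases "card D = 0") (simp_all add: approx_ratio_def D(2) C_def divide_le_eq)
  also have "\<dots> \<le> rho' \<beta>"
    using rho'_ge[OF \<open>\<beta> > 2\<close>] by (simp add: \<delta>_def p_def \<tau>_def)
  finally show ?thesis .
qed

theorem theorem2:
  fixes \<beta> :: real
  assumes "\<beta> > 2.424"
  shows "\<exists>A. poly_time_vc_algorithm A \<and>
           Limsup at_top
             (\<lambda>\<alpha>::real. ereal (measure_pmf.expectation (power_law_graph \<alpha> \<beta>) (approx_ratio A)))
           \<le> ereal (rho' \<beta>)"
proof (intro exI conjI Limsup_bounded)
  show "poly_time_vc_algorithm leaf_greedy" by (rule poly_time_vc_algorithm_leaf_greedy)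
  \<comment> \<open>The gap of \<open>numeric_gap\<close>; the bound holds as soon as
    \<open>exp \<alpha> \<ge> 1 / g\<close>.\<close>
  define g where "g = 1 - 8 powr (2 - \<beta>) / ((\<beta> - 1) * (\<beta> - 2)) -
    4 * ((5 / 2) powr (1 - \<beta>) / (\<beta> - 1)) * (2 powr (- \<beta>) + (5 / 2) powr (1 - \<beta>) / (\<beta> - 1))"
  have "g > 0" unfolding g_def using numeric_gap[OF assms] by simp
  have "eventually (\<lambda>\<alpha>::real. 1 / g \<le> exp \<alpha>) at_top"
    using exp_at_top by (simp add: filterlim_at_top)
  thus "\<forall>\<^sub>F \<alpha> in at_top. ereal (measure_pmf.expectation (power_law_graph \<alpha> \<beta>) (approx_ratio leaf_greedy))
      \<le> ereal (rho' \<beta>)"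
    using eventually_gt_at_top[of 0]
  proof eventually_elim
    case (elim \<alpha>)
    have "exp \<alpha> * g \<ge> 1" using elim \<open>g > 0\<close> by (simp add: field_simps)
    \<comment> \<open>A bound on the whole support passes to the expectation; finiteness of the
      support gives integrability.\<close>
    hence "approx_ratio leaf_greedy G \<le> rho' \<beta>" if "G \<in> set_pmf (power_law_graph \<alpha> \<beta>)" for G
      using approx_ratio_leaf_greedy_le[OF assms elim(2) that] unfolding g_def by simp
    moreover have "finite (set_pmf (power_law_graph \<alpha> \<beta>))"
      using elim assms by (subst set_pmf_power_law_graph)
        (auto intro: finite_perfect_matchings finite_vertex_copies)
    ultimately show ?case
      by (auto intro!: measure_pmf.integral_le_const integrable_measure_pmf_finite
          simp: AE_measure_pmf_iff)
  qed
qed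

end
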